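(* Consider the endowment economy with a representative agent having contemporaneous gain-loss utility only, described in the context (Model II), with parameters $\theta>0$, $\beta>0$, $b\ge0$, $\lambda\ge1$. Write $A(x):=1+bF_{\varepsilon_c}(x)+b\lambda(1-F_{\varepsilon_c}(x))$. Assume the growth condition $$\beta\,\mathbb E_t\big[\varepsilon_{c,t+1}^{-\theta}\varepsilon_{d,t+1}\big]<1.$$ Then there exists an equilibrium with risk-free return $$R_{f,t+1}=\frac{A(\varepsilon_{c,t})}{\beta\,\mathbb E\big[\varepsilon_{c,t+1}^{-\theta}A(\varepsilon_{c,t+1})\big]}$$ and stock price-dividend ratio $$\frac{S_t}{D_t}=\frac{\beta\,\mathbb E_t\big[\varepsilon_{c,t+1}^{-\theta}\varepsilon_{d,t+1}A(\varepsilon_{c,t+1})\big]}{A(\varepsilon_{c,t})\Big(1-\beta\,\mathbb E_t\big[\varepsilon_{c,t+1}^{-\theta}\varepsilon_{d,t+1}\big]\Big)}.$$ In addition, the stock return is $$R_{S,t+1}=A(\varepsilon_{c,t})\,\varepsilon_{d,t+1}\left(\frac{1-\beta\,\mathbb E_t\big[\varepsilon_{c,t+1}^{-\theta}\varepsilon_{d,t+1}\big]}{\beta\,\mathbb E_t\big[\varepsilon_{c,t+1}^{-\theta}\varepsilon_{d,t+1}A(\varepsilon_{c,t+1})\big]}+\frac{1}{A(\varepsilon_{c,t+1})}\right),$$ and the conditional risk premium is $$\mathbb E_t[R_{S,t+1}]-R_{f,t+1}=A(\varepsilon_{c,t})\left(\mathbb E_t\left[\frac{\varepsilon_{d,t+1}}{A(\varepsilon_{c,t+1})}\right]+\frac{\mathbb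 E_t[\varepsilon_{d,t+1}]\Big(1-\beta\,\mathbb E_t\big[\varepsilon_{c,t+1}^{-\theta}\varepsilon_{d,t+1}\big]\Big)}{\beta\,\mathbb E_t\big[\varepsilon_{c,t+1}^{-\theta}\varepsilon_{d,t+1}A(\varepsilon_{c,t+1})\big]}-\frac{1}{\beta\,\mathbb E_t\big[\varepsilon_{c,t+1}^{-\theta}A(\varepsilon_{c,t+1})\big]}\right).$$
   Context: **Market.** Discrete time $t=0,1,\dots$. A risk-free asset in zero net supply has gross return $R_{f,t+1}$ (known at time $t$) over $[t,t+1]$. A stock in unit net supply has price $S_t$, pays dividends $D_t>0$, and has gross return $R_{S,t+1}=(S_{t+1}+D_{t+1})/S_t$. Aggregate consumption is $\bar C_t>0$. Put $\varepsilon_{c,t+1}=\bar C_{t+1}/\bar C_t$, $\varepsilon_{d,t+1}=D_{t+1}/D_t$, $Y_t=\bar C_t/D_t$; hence $\varepsilon_{d,t+1}=\varepsilon_{c,t+1}Y_t/Y_{t+1}$. Let $\mathcal F_t$ be the filtration generated by the consumption and dividend growth rates up to time $t$ (initial levels being known), and $\mathbb E_t=\mathbb E[\cdot\mid\mathcal F_t]$. The $\varepsilon_{c,t}$ are i.i.d. with continuous cumulative distribution function $F_{\varepsilon_c}$, $\varepsilon_{c,t+1}$ is independent of $\mathcal F_t$, $\{Y_t\}$ is a Markov chain, and the conditional law of $(\varepsilon_{c,t+1},Y_{t+1})$ given $\mathcal F_t$ depends only on $Y_t$. (Leading specification: $\log\varepsilon_{c,t+1}=\mu_c+\sigma_cz_{t+1}$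 and $\log Y_{t+1}=(1-\varphi)\kappa+\varphi\log Y_t+\sigma_y\epsilon_{t+1}$ with $z_t$, $\epsilon_t$ i.i.d. standard normal.) **Agent.** At time $t$ the agent chooses consumption $C_t$ and the fraction $\alpha_t$ of post-consumption wealth invested in the stock. She receives labor income $L_t=\bar C_t-D_t$, and wealth evolves as $W_{t+1}=(W_t-C_t)(\alpha_tR_{S,t+1}+(1-\alpha_t)R_{f,t+1})+L_{t+1}$. She maximizes $\mathbb E_t[\sum_{s\ge t}\beta^{s-t}U_s(C_s)]$, where $$U_s(C_s)=m(C_s)+b\,\mathbb E_s\big[\mu(m(C_s)-m(\tilde C_{s-1,s}))\big],$$ $m(x)=x^{1-\theta}/(1-\theta)$ for $0<\theta\ne1$, $m(x)=\log x$ for $\theta=1$; $\mu(x)=x$ for $x\ge0$, $\mu(x)=\lambda x$ for $x<0$. The reference points $\tilde C_{s-1,s}$ are taken as given by the agent; $\tilde C_{s-1,s}$ is the expectation held at time $s-1$ about consumption at $s$, and it is independent of $\mathcal F_\infty$ given $\mathcal F_{s-1}$ (so each outcome of $C_s$ is compared with every possible outcome of the reference point). Optimal quantities are denoted $C_t^\star$, $\alpha_t^\star$. **Equilibrium.** The economy is in equilibrium with asset prices $(R_{f,t+1},S_t)_{t\ge0}$ if (i) $C_t^\star=\bar C_t$; (ii) $\alpha_t^\star=1$; (iii) $\tilde C_{t-1,t}$ is identically distributed as $C_t^\star$ conditional on $\mathcal F_{t-1}$ (so $\tilde C_{t-1,t}=\bar C_{t-1}\tilde\varepsilon_{c,t}$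 with $\tilde\varepsilon_{c,t}$ an independent copy of $\varepsilon_{c,t}$).
   Formalization: Added: the ratio βE_t[ε_c^{-θ}ε_d A]/(1−βE_t[ε_c^{-θ}ε_d]) is constant over time (the price-dividend and stock-return formulas together force it); post-consumption wealth is nonnegative (no Ponzi schemes); the moments and lifetime utility involved exist. *)

theory Defs
  imports "HOL-Probability.Probability"
begin

text \<open>
  Conditional expectations are \<^const>\<open>real_cond_exp\<close>. It is the difference of the extended nonnegative
  conditional expectations of the positive and the negative part, so it is meaningful for random
  variables that are merely conditionally (not unconditionally) integrable.
\<close>

definition cond_integrable :: "'a measure \<Rightarrow> 'a measure \<Rightarrow> ('a \<Rightarrow> real) \<Rightarrow> bool" where
  "cond_integrable M G X \<longleftrightarrow>
     X \<in> borel_measurable M \<and> (AE \<omega> in M. nn_cond_exp M G (\<lambda>\<omega>. ennreal \<bar>X \<omega>\<bar>) \<omega> < \<infinity>)"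

definition cond_ident_distr ::
  "'a measure \<Rightarrow> 'a measure \<Rightarrow> ('a \<Rightarrow> real) \<Rightarrow> ('a \<Rightarrow> real) \<Rightarrow> bool" where
  "cond_ident_distr M G X Z \<longleftrightarrow>
     (\<forall>B \<in> sets borel. AE \<omega> in M.
        real_cond_exp M G (\<lambda>\<omega>. indicator B (X \<omega>)) \<omega> = real_cond_exp M G (\<lambda>\<omega>. indicator B (Z \<omega>)) \<omega>)"

definition cond_indep ::
  "'a measure \<Rightarrow> 'a measure \<Rightarrow> ('a \<Rightarrow> real) \<Rightarrow> 'a measure \<Rightarrow> bool" where
  "cond_indep M G X H \<longleftrightarrow>
     (\<forall>B \<in> sets borel. \<forall>K \<in> sets H. AE \<omega> in M.
        real_cond_exp M G (\<lambda>\<omega>. indicator B (X \<omega>) * indicator K \<omega>) \<omega>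
        = real_cond_exp M G (\<lambda>\<omega>. indicator B (X \<omega>)) \<omega> * real_cond_exp M G (indicator K) \<omega>)"

text \<open>
  Time convention: \<open>c0\<close> and \<open>d0\<close> are the known levels of aggregate consumption and dividends at
  date \<open>-1\<close>, and \<open>ec t\<close>, \<open>ed t\<close> are the gross growth rates from date \<open>t - 1\<close> to date \<open>t\<close>, for
  \<open>t = 0, 1, \<dots>\<close>. Hence the growth rate at date \<open>0\<close>, on which the prices at date \<open>0\<close> depend, is
  defined. \<open>level\<close> is the level at date \<open>t\<close> and \<open>prev_level\<close> the level at date \<open>t - 1\<close>.
\<close>

definition level :: "real \<Rightarrow> (nat \<Rightarrow> 'a \<Rightarrow> real) \<Rightarrow> nat \<Rightarrow> 'a \<Rightarrow> real" where
  "level x0 g t \<omega> = x0 * (\<Prod>i\<le>t. g i \<omega>)"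

definition prev_level :: "real \<Rightarrow> (nat \<Rightarrow> 'a \<Rightarrow> real) \<Rightarrow> nat \<Rightarrow> 'a \<Rightarrow> real" where
  "prev_level x0 g t \<omega> = x0 * (\<Prod>i<t. g i \<omega>)"

text \<open>
  The information generated by the growth rates at the dates in \<open>I\<close>: the dates \<open>{..t}\<close> give the
  sigma-algebra of date \<open>t\<close>, \<open>{..<t}\<close> that of date \<open>t - 1\<close> (trivial for \<open>t = 0\<close>), and \<open>UNIV\<close> the
  terminal sigma-algebra.
\<close>

definition info ::
  "'a measure \<Rightarrow> (nat \<Rightarrow> 'a \<Rightarrow> real) \<Rightarrow> (nat \<Rightarrow> 'a \<Rightarrow> real) \<Rightarrow> nat set \<Rightarrow> 'a measure" where
  "info M ec ed I =
     sigma (space M) {(\<lambda>\<omega>. (ec i \<omega>, ed i \<omega>)) -` B \<inter> space M | i B. i \<in> I \<and> B \<in> sets borel}"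

text \<open>
  The exogenous economy. The assumption \<open>markov\<close> says that the conditional law of next period's
  consumption growth and consumption-dividend ratio given the current information depends only on the
  current ratio; in particular the ratio is a (possibly time-inhomogeneous) Markov chain. The random
  variables \<open>etil t\<close> are the independent copies of consumption growth underlying the reference points.
\<close>

locale endowment_economy = prob_space M
  for M :: "'a measure" +
  fixes c0 d0 :: real and ec ed etil :: "nat \<Rightarrow> 'a \<Rightarrow> real"
  assumes c0_pos: "c0 > 0" and d0_pos: "d0 > 0"
    and ec_meas: "\<And>t. ec t \<in> borel_measurable M"
    and ed_meas: "\<And>t. ed t \<in> borel_measurable M"
    and ec_pos: "\<And>t \<omega>. \<omega> \<in> space M \<Longrightarrow> ec t \<omega> > 0"
    and ed_pos: "\<And>t \<omega>. \<omega> \<in> space M \<Longrightarrow> ed t \<omega> > 0"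
    and ec_indep: "indep_vars (\<lambda>_. borel) ec UNIV"
    and ec_ident: "\<And>t. distr M borel (ec t) = distr M borel (ec 0)"
    and ec_cdf: "continuous_on UNIV (cdf (distr M borel (ec 0)))"
    and ec_indep_past: "\<And>t. indep_set (sets (vimage_algebra (space M) (ec (Suc t)) borel))
                                   (sets (info M ec ed {..t}))"
    and markov: "\<And>t B. B \<in> sets borel \<Longrightarrow>
      let Y = (\<lambda>t \<omega>. level c0 ec t \<omega> / level d0 ed t \<omega>);
          next_in_B = (\<lambda>\<omega>. indicator B (ec (Suc t) \<omega>, Y (Suc t) \<omega>))
      in AE \<omega> in M. real_cond_exp M (info M ec ed {..t}) next_in_B \<omega>
                  = real_cond_exp M (vimage_algebra (space M) (Y t) borel) next_in_B \<omega>"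
    and etil_meas: "\<And>t. etil t \<in> borel_measurable M"
    and etil_ident: "\<And>t. distr M borel (etil t) = distr M borel (ec 0)"
    and etil_indep: "\<And>t. indep_set (sets (vimage_algebra (space M) (etil t) borel))
                                (sets (info M ec ed UNIV))"

definition crra :: "real \<Rightarrow> real \<Rightarrow> real" where
  "crra \<theta> x = (if \<theta> = 1 then ln x else x powr (1 - \<theta>) / (1 - \<theta>))"

definition gain_loss :: "real \<Rightarrow> real \<Rightarrow> real" where
  "gain_loss lam x = (if x \<ge> 0 then x else lam * x)"

text \<open>
  Period utility of consumption \<open>C\<close> with reference point \<open>R\<close>; \<open>G\<close> is the information at the date of
  consumption.
\<close>

definition period_utility ::
  "'a measure \<Rightarrow> 'a measure \<Rightarrow> real \<Rightarrow> real \<Rightarrow> real \<Rightarrow> ('a \<Rightarrow> real) \<Rightarrow> ('a \<Rightarrow> real) \<Rightarrow> 'a \<Rightarrow> real" where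
  "period_utility M G \<theta> b lam R C \<omega> =
     crra \<theta> (C \<omega>)
     + b * real_cond_exp M G (\<lambda>\<omega>. gain_loss lam (crra \<theta> (C \<omega>) - crra \<theta> (R \<omega>))) \<omega>"

text \<open>
  Conditional expectation, given \<open>G\<close>, of the discounted sum from date \<open>t\<close> on of a stream \<open>u\<close>, as an
  extended real: the expected discounted sum of the positive parts (\<^const>\<open>ennreal\<close> maps negative
  reals to \<open>0\<close>) minus that of the negative parts. It is undefined where both are infinite.
\<close>

definition discounted_gain ::
  "'a measure \<Rightarrow> 'a measure \<Rightarrow> real \<Rightarrow> (nat \<Rightarrow> 'a \<Rightarrow> real) \<Rightarrow> nat \<Rightarrow> 'a \<Rightarrow> ennreal" where
  "discounted_gain M G \<beta> u t = nn_cond_exp M G (\<lambda>\<omega>. \<Sum>j. ennreal (\<beta> ^ j * u (t + j) \<omega>))"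

definition lifetime_defined ::
  "'a measure \<Rightarrow> 'a measure \<Rightarrow> real \<Rightarrow> (nat \<Rightarrow> 'a \<Rightarrow> real) \<Rightarrow> nat \<Rightarrow> 'a \<Rightarrow> bool" where
  "lifetime_defined M G \<beta> u t \<omega> \<longleftrightarrow>
     discounted_gain M G \<beta> u t \<omega> < \<infinity> \<or> discounted_gain M G \<beta> (\<lambda>s \<omega>. - u s \<omega>) t \<omega> < \<infinity>"

definition lifetime_utility ::
  "'a measure \<Rightarrow> 'a measure \<Rightarrow> real \<Rightarrow> (nat \<Rightarrow> 'a \<Rightarrow> real) \<Rightarrow> nat \<Rightarrow> 'a \<Rightarrow> ereal" where
  "lifetime_utility M G \<beta> u t \<omega> =
     enn2ereal (discounted_gain M G \<beta> u t \<omega>)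
     - enn2ereal (discounted_gain M G \<beta> (\<lambda>s \<omega>. - u s \<omega>) t \<omega>)"

text \<open>\<open>stock_return S D t\<close> and \<open>Rf t\<close> are the gross returns over the period from \<open>t\<close> to \<open>t + 1\<close>.\<close>

definition stock_return ::
  "(nat \<Rightarrow> 'a \<Rightarrow> real) \<Rightarrow> (nat \<Rightarrow> 'a \<Rightarrow> real) \<Rightarrow> nat \<Rightarrow> 'a \<Rightarrow> real" where
  "stock_return S D t \<omega> = (S (Suc t) \<omega> + D (Suc t) \<omega>) / S t \<omega>"

text \<open>
  Wealth before consumption. The agent starts with the one unit of stock in net supply, so initial
  wealth is the cum-dividend stock price plus labor income. \<open>Cbar\<close> is aggregate consumption, and
  \<open>a\<close> the fraction of post-consumption wealth held in the stock.
\<close>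

fun wealth :: "(nat \<Rightarrow> 'a \<Rightarrow> real) \<Rightarrow> (nat \<Rightarrow> 'a \<Rightarrow> real) \<Rightarrow> (nat \<Rightarrow> 'a \<Rightarrow> real) \<Rightarrow> (nat \<Rightarrow> 'a \<Rightarrow> real) \<Rightarrow>
    (nat \<Rightarrow> 'a \<Rightarrow> real) \<Rightarrow> (nat \<Rightarrow> 'a \<Rightarrow> real) \<Rightarrow> nat \<Rightarrow> 'a \<Rightarrow> real" where
  "wealth Rf S Cbar D C a 0 \<omega> = S 0 \<omega> + D 0 \<omega> + (Cbar 0 \<omega> - D 0 \<omega>)"
| "wealth Rf S Cbar D C a (Suc t) \<omega> =
     (wealth Rf S Cbar D C a t \<omega> - C t \<omega>)
       * (a t \<omega> * stock_return S D t \<omega> + (1 - a t \<omega>) * Rf t \<omega>)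
     + (Cbar (Suc t) \<omega> - D (Suc t) \<omega>)"

text \<open>
  Consumption is positive and post-consumption wealth is nonnegative. Some such solvency constraint
  is needed to exclude Ponzi schemes, without which no optimum exists. The portfolio share is
  unrestricted.
\<close>

definition admissible :: "'a measure \<Rightarrow> (nat \<Rightarrow> 'a measure) \<Rightarrow> (nat \<Rightarrow> 'a \<Rightarrow> real) \<Rightarrow> (nat \<Rightarrow> 'a \<Rightarrow> real) \<Rightarrow>
    (nat \<Rightarrow> 'a \<Rightarrow> real) \<Rightarrow> (nat \<Rightarrow> 'a \<Rightarrow> real) \<Rightarrow> (nat \<Rightarrow> 'a \<Rightarrow> real) \<Rightarrow> (nat \<Rightarrow> 'a \<Rightarrow> real) \<Rightarrow> bool" where
  "admissible M F Rf S Cbar D C a \<longleftrightarrow>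
     (\<forall>t. C t \<in> borel_measurable (F t) \<and> a t \<in> borel_measurable (F t) \<and>
       (AE \<omega> in M. 0 < C t \<omega> \<and> 0 \<le> wealth Rf S Cbar D C a t \<omega> - C t \<omega>))"

text \<open>
  A plan is optimal if at every date \<open>t\<close> its continuation maximizes conditional lifetime utility among
  all admissible plans that coincide with it before \<open>t\<close> and hence lead to the same wealth at \<open>t\<close>.
\<close>

definition optimal_plan :: "'a measure \<Rightarrow> (nat \<Rightarrow> 'a measure) \<Rightarrow>
    real \<Rightarrow> real \<Rightarrow> real \<Rightarrow> real \<Rightarrow> (nat \<Rightarrow> 'a \<Rightarrow> real) \<Rightarrow>
    (nat \<Rightarrow> 'a \<Rightarrow> real) \<Rightarrow> (nat \<Rightarrow> 'a \<Rightarrow> real) \<Rightarrow> (nat \<Rightarrow> 'a \<Rightarrow> real) \<Rightarrow> (nat \<Rightarrow> 'a \<Rightarrow> real) \<Rightarrow>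
    (nat \<Rightarrow> 'a \<Rightarrow> real) \<Rightarrow> (nat \<Rightarrow> 'a \<Rightarrow> real) \<Rightarrow> bool" where
  "optimal_plan M F \<theta> \<beta> b lam R Rf S Cbar D C a \<longleftrightarrow>
     (let U = (\<lambda>X s. period_utility M (F s) \<theta> b lam (R s) (X s)) in
      admissible M F Rf S Cbar D C a \<and>
      (\<forall>t. AE \<omega> in M. lifetime_defined M (F t) \<beta> (U C) t \<omega>) \<and>
      (\<forall>t C' a'. admissible M F Rf S Cbar D C' a' \<longrightarrow>
         (\<forall>s<t. AE \<omega> in M. C' s \<omega> = C s \<omega> \<and> a' s \<omega> = a s \<omega>) \<longrightarrow>
         (AE \<omega> in M. lifetime_defined M (F t) \<beta> (U C') t \<omega> \<longrightarrow>
            lifetime_utility M (F t) \<beta> (U C') t \<omega> \<le> lifetime_utility M (F t) \<beta> (U C) t \<omega>)))"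

text \<open>
  Here \<open>R t\<close> is the reference point for consumption at date \<open>t\<close>, held at date \<open>t - 1\<close>; it is a fixed
  argument of \<^const>\<open>optimal_plan\<close>, i.e. the agent takes it as given.
\<close>

definition equilibrium :: "'a measure \<Rightarrow> real \<Rightarrow> real \<Rightarrow> (nat \<Rightarrow> 'a \<Rightarrow> real) \<Rightarrow> (nat \<Rightarrow> 'a \<Rightarrow> real) \<Rightarrow>
    real \<Rightarrow> real \<Rightarrow> real \<Rightarrow> real \<Rightarrow>
    (nat \<Rightarrow> 'a \<Rightarrow> real) \<Rightarrow> (nat \<Rightarrow> 'a \<Rightarrow> real) \<Rightarrow> (nat \<Rightarrow> 'a \<Rightarrow> real) \<Rightarrow> bool" where
  "equilibrium M c0 d0 ec ed \<theta> \<beta> b lam R Rf S \<longleftrightarrow>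
     (let F = (\<lambda>t. info M ec ed {..t}); Cbar = level c0 ec; D = level d0 ed in
      (\<forall>t. Rf t \<in> borel_measurable (F t) \<and> S t \<in> borel_measurable (F t) \<and> (AE \<omega> in M. S t \<omega> > 0)) \<and>
      (\<forall>t. R t \<in> borel_measurable M \<and> cond_indep M (info M ec ed {..<t}) (R t) (info M ec ed UNIV)) \<and>
      (\<exists>Cstar astar. optimal_plan M F \<theta> \<beta> b lam R Rf S Cbar D Cstar astar \<and>
         (\<forall>t. AE \<omega> in M. Cstar t \<omega> = Cbar t \<omega>) \<and>
         (\<forall>t. AE \<omega> in M. astar t \<omega> = 1) \<and>
         (\<forall>t. cond_ident_distr M (info M ec ed {..<t}) (R t) (Cstar t))))"

end

theory Submission
  imports Defs
begin

text \<open>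
  Period utility is concave in consumption, and at \<open>C = Cbar\<close> its supergradient is
  \<open>Q t = A (ec t) * Cbar t powr - \<theta>\<close>, because the reference point lies below the consumption
  \<open>Cbar t\<close> with conditional probability \<open>Feps (ec t)\<close>. The asset prices are those with pricing kernel
  \<open>\<beta> * Q (Suc t) / Q t\<close>. For an arbitrary admissible plan the budget constraint then gives, after \<open>n\<close>
  periods, that its utility gain over \<open>Cbar\<close> is at most the conditional expectation of
  \<open>\<beta> ^ n * Q (t + n) * S (t + n)\<close>, since post-consumption wealth is nonnegative. Integrability is not
  an issue: positive and negative parts are kept on opposite sides of inequalities between extended
  nonnegative reals. Finally, \<open>q t = \<beta> * h t / (1 - \<beta> * k t)\<close> is constant in time and \<open>h t \<ge> (1 + b) * k t\<close>,
  so \<open>\<beta> * k t \<le> q t / (1 + b + q t) < 1\<close> uniformly in \<open>t\<close>; this geometric rate is the transversality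
  condition.
\<close>

section \<open>Conditional expectations\<close>

text \<open>The portfolio share is unrestricted, so a plan may lever arbitrarily and a priori
  neither its wealth nor its utility has a mean. Hence every estimate is conditional on one date,
  and the only terms cancelled are those already shown to have a finite conditional value: the
  stock, aggregate consumption, and next-period wealth of an admissible plan. Constancy of
  \<open>q\<close> enters through the Euler equation of the stock. The factor \<open>A\<close>
  cancels in \<open>Q * S\<close>, so that equation says that \<open>q t\<close> is the conditional
  mean of \<open>\<beta> * ec (Suc t) powr (- \<theta>) * ed (Suc t) * (q (Suc t) + A (ec (Suc
  t)))\<close>. Once \<open>q (Suc t)\<close> may be replaced by \<open>q t\<close>, this is a
  linear equation solved by \<open>\<beta> * h t / (1 - \<beta> * k t)\<close>. The same replacement
  yields the return formula and allows the transversality bound to be iterated: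
  \<open>\<beta> * k t < 1\<close> at every date would by itself leave open that products of these
  factors stay away from zero.\<close>

context sigma_finite_subalgebra
begin

text \<open>Integrated over a set of \<open>F\<close>, both sides become the same series of
  integrals, and this characterises the conditional expectation. It later opens the discounted sum
  in \<open>discounted_gain\<close> term by term, with no convergence to check.\<close>

lemma nn_cond_exp_suminf:
  assumes [measurable]: "\<And>i. f i \<in> borel_measurable M"
  shows "AE x in M. (\<Sum>i. nn_cond_exp M F (f i) x) = nn_cond_exp M F (\<lambda>x. \<Sum>i. f i x) x"
proof (rule nn_cond_exp_charact)
  fix A assume A: "A \<in> sets F"
  then have [measurable]: "A \<in> sets M" "indicator A \<in> borel_measurable F"
    using subalg by (auto simp: subalgebra_def)
  have "(\<integral>\<^sup>+ x\<in>A. (\<Sum>i. f i x) \<partial>M) = (\<Sum>i. \<integral>\<^sup>+ x. indicator A x * f i x \<partial>M)"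
    by (subst nn_integral_suminf[symmetric]) (auto simp: mult.commute)
  also have "\<dots> = (\<Sum>i. \<integral>\<^sup>+ x. indicator A x * nn_cond_exp M F (f i) x \<partial>M)"
    by (simp add: nn_cond_exp_intg)
  also have "\<dots> = (\<integral>\<^sup>+ x\<in>A. (\<Sum>i. nn_cond_exp M F (f i) x) \<partial>M)"
    by (subst nn_integral_suminf[symmetric]) (auto simp: mult.commute)
  finally show "(\<integral>\<^sup>+ x\<in>A. (\<Sum>i. f i x) \<partial>M) = (\<integral>\<^sup>+ x\<in>A. (\<Sum>i. nn_cond_exp M F (f i) x) \<partial>M)" .
qed auto

lemma nn_cond_exp_finite_sum:
  assumes [measurable]: "\<And>i. f i \<in> borel_measurable M"
  shows "AE x in M. (\<Sum>i<n::nat. nn_cond_exp M F (f i) x) = nn_cond_exp M F (\<lambda>x. \<Sum>i<n. f i x) x"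
proof (induction n)
  case 0
  show ?case
    using nn_cond_exp_F_meas[of "\<lambda>_. 0"] by simp
next
  case (Suc n)
  then show ?case
    using nn_cond_exp_sum[of "\<lambda>x. \<Sum>i<n. f i x" "f n"] by auto
qed

lemma nn_cond_exp_sum3:
  assumes [measurable]: "f1 \<in> borel_measurable M" "f2 \<in> borel_measurable M" "f3 \<in> borel_measurable M"
  shows "AE x in M. nn_cond_exp M F (\<lambda>x. f1 x + (f2 x + f3 x)) x
      = nn_cond_exp M F f1 x + (nn_cond_exp M F f2 x + nn_cond_exp M F f3 x)"
  using nn_cond_exp_sum[of f1 "\<lambda>x. f2 x + f3 x"] nn_cond_exp_sum[of f2 f3] by auto

lemma nn_cond_exp_sum4:
  assumes [measurable]: "f1 \<in> borel_measurable M" "f2 \<in> borel_measurable M" "f3 \<in> borel_measurable M" "f4 \<in> borel_measurable M"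
  shows "AE x in M. nn_cond_exp M F (\<lambda>x. f1 x + (f2 x + (f3 x + f4 x))) x
      = nn_cond_exp M F f1 x + (nn_cond_exp M F f2 x + (nn_cond_exp M F f3 x + nn_cond_exp M F f4 x))"
  using nn_cond_exp_sum[of f1 "\<lambda>x. f2 x + (f3 x + f4 x)"] nn_cond_exp_sum3[of f2 f3 f4] by auto

text \<open>The event where the conditional expectation vanishes lies in \<open>F\<close>, so the
  integral of \<open>f\<close> over it is zero; a positive \<open>f\<close> allows this only on a
  null set.\<close>

lemma nn_cond_exp_pos:
  assumes [measurable]: "f \<in> borel_measurable M" and pos: "AE x in M. 0 < f x"
  shows "AE x in M. 0 < nn_cond_exp M F f x"
proof -
  define B where "B = {x \<in> space M. nn_cond_exp M F f x = 0}"
  have sp: "space M = space F" using subalg by (simp add: subalgebra_def)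
  have BF: "B \<in> sets F" unfolding B_def sp by measurable
  then have [measurable]: "indicator B \<in> borel_measurable F" "B \<in> sets M"
    using subalg by (auto simp: subalgebra_def)
  have "(\<integral>\<^sup>+ x. indicator B x * f x \<partial>M) = (\<integral>\<^sup>+ x. indicator B x * nn_cond_exp M F f x \<partial>M)"
    by (simp add: nn_cond_exp_intg)
  also have "\<dots> = (\<integral>\<^sup>+ x. 0 \<partial>M)"
    by (rule nn_integral_cong) (auto simp: B_def indicator_def)
  finally have "AE x in M. indicator B x * f x = 0"
    by (simp add: nn_integral_0_iff_AE)
  with pos show ?thesis
    by (auto simp: B_def indicator_def zero_less_iff_neq_zero split: if_splits)
qed

section \<open>Real conditional expectations under conditional integrability\<close>

lemma cond_integrableD:
  assumes "cond_integrable M F X"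
  shows "X \<in> borel_measurable M"
    "AE x in M. nn_cond_exp M F (\<lambda>x. ennreal (X x)) x < \<infinity>"
    "AE x in M. nn_cond_exp M F (\<lambda>x. ennreal (- X x)) x < \<infinity>"
proof -
  show [measurable]: "X \<in> borel_measurable M" using assms by (simp add: cond_integrable_def)
  have fin: "AE x in M. nn_cond_exp M F (\<lambda>x. ennreal \<bar>X x\<bar>) x < \<infinity>"
    using assms by (simp add: cond_integrable_def)
  have "AE x in M. nn_cond_exp M F (\<lambda>x. ennreal (X x)) x \<le> nn_cond_exp M F (\<lambda>x. ennreal \<bar>X x\<bar>) x"
    by (rule nn_cond_exp_mono) (auto intro: ennreal_leI)
  with fin show "AE x in M. nn_cond_exp M F (\<lambda>x. ennreal (X x)) x < \<infinity>" by (auto intro: le_less_trans)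
  have "AE x in M. nn_cond_exp M F (\<lambda>x. ennreal (- X x)) x \<le> nn_cond_exp M F (\<lambda>x. ennreal \<bar>X x\<bar>) x"
    by (rule nn_cond_exp_mono) (auto intro: ennreal_leI)
  with fin show "AE x in M. nn_cond_exp M F (\<lambda>x. ennreal (- X x)) x < \<infinity>" by (auto intro: le_less_trans)
qed

lemma cond_integrable_bound:
  assumes Y: "cond_integrable M F Y" and [measurable]: "X \<in> borel_measurable M"
    and le: "AE x in M. \<bar>X x\<bar> \<le> \<bar>Y x\<bar>"
  shows "cond_integrable M F X"
proof -
  have [measurable]: "Y \<in> borel_measurable M" using Y by (simp add: cond_integrable_def)
  have "AE x in M. nn_cond_exp M F (\<lambda>x. ennreal \<bar>X x\<bar>) x \<le> nn_cond_exp M F (\<lambda>x. ennreal \<bar>Y x\<bar>) x"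
    using le by (intro nn_cond_exp_mono) (auto intro: ennreal_leI)
  then show ?thesis
    using Y by (auto simp: cond_integrable_def intro: le_less_trans)
qed

text \<open>A variable known under \<open>F\<close> is its own conditional expectation, hence
  conditionally integrable whatever its moments. This is how consumption of an arbitrary admissible
  plan is handled.\<close>

lemma cond_integrable_F_meas:
  assumes [measurable]: "X \<in> borel_measurable F"
  shows "cond_integrable M F X"
proof -
  have "AE x in M. ennreal \<bar>X x\<bar> = nn_cond_exp M F (\<lambda>x. ennreal \<bar>X x\<bar>) x"
    by (rule nn_cond_exp_F_meas) auto
  moreover have "X \<in> borel_measurable M" by (rule measurable_from_subalg[OF subalg assms])
  ultimately show ?thesis
    unfolding cond_integrable_def by (auto elim!: eventually_mono) (metis ennreal_less_top)
qed

lemma cond_integrable_integrable: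
  assumes "integrable M X"
  shows "cond_integrable M F X"
proof -
  have [measurable]: "X \<in> borel_measurable M" using assms by auto
  have "(\<integral>\<^sup>+ x. nn_cond_exp M F (\<lambda>x. ennreal \<bar>X x\<bar>) x \<partial>M) = (\<integral>\<^sup>+ x. ennreal \<bar>X x\<bar> \<partial>M)"
    using nn_cond_exp_intg[of "\<lambda>_. 1" "\<lambda>x. ennreal \<bar>X x\<bar>"] by simp
  also have "\<dots> < \<infinity>"
    using assms by (simp add: integrable_iff_bounded)
  finally have "AE x in M. nn_cond_exp M F (\<lambda>x. ennreal \<bar>X x\<bar>) x \<noteq> \<infinity>"
    by (intro nn_integral_PInf_AE) auto
  then show ?thesis
    unfolding cond_integrable_def by (auto simp: less_top)
qed

text \<open>Positive and negative parts are put on opposite sides, where conditional expectations of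
  nonnegative functions add up. The resulting equation can be read in the reals because all six
  conditional expectations are finite.\<close>

lemma cond_integrable_add:
  assumes X: "cond_integrable M F X" and Y: "cond_integrable M F Y"
  shows "cond_integrable M F (\<lambda>x. X x + Y x)"
    "AE x in M. real_cond_exp M F (\<lambda>x. X x + Y x) x = real_cond_exp M F X x + real_cond_exp M F Y x"
proof -
  note [measurable] = cond_integrableD(1)[OF X] cond_integrableD(1)[OF Y]
  have "AE x in M. nn_cond_exp M F (\<lambda>x. ennreal \<bar>X x + Y x\<bar>) x
      \<le> nn_cond_exp M F (\<lambda>x. ennreal \<bar>X x\<bar> + ennreal \<bar>Y x\<bar>) x"
    by (intro nn_cond_exp_mono) (auto simp flip: ennreal_plus intro!: ennreal_leI)
  moreover have "AE x in M. nn_cond_exp M F (\<lambda>x. ennreal \<bar>X x\<bar>) x + nn_cond_exp M F (\<lambda>x. ennreal \<bar>Y x\<bar>) x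
      = nn_cond_exp M F (\<lambda>x. ennreal \<bar>X x\<bar> + ennreal \<bar>Y x\<bar>) x"
    by (rule nn_cond_exp_sum) auto
  moreover have "AE x in M. nn_cond_exp M F (\<lambda>x. ennreal \<bar>X x\<bar>) x < \<infinity>"
    "AE x in M. nn_cond_exp M F (\<lambda>x. ennreal \<bar>Y x\<bar>) x < \<infinity>"
    using X Y by (auto simp: cond_integrable_def)
  ultimately have "AE x in M. nn_cond_exp M F (\<lambda>x. ennreal \<bar>X x + Y x\<bar>) x < \<infinity>"
  proof eventually_elim
    case (elim x)
    have "nn_cond_exp M F (\<lambda>x. ennreal \<bar>X x\<bar>) x + nn_cond_exp M F (\<lambda>x. ennreal \<bar>Y x\<bar>) x < \<infinity>"
      using elim(3,4) by simp
    then show ?case using elim(1,2) by (simp add: order_le_less_trans)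
  qed
  then show XY: "cond_integrable M F (\<lambda>x. X x + Y x)" by (simp add: cond_integrable_def)
  \<comment> \<open>The parts of \<open>u + v\<close> are in general not the sums of the parts of
    \<open>u\<close> and \<open>v\<close>; only the differences agree, which is this
    subtraction-free identity.\<close>
  have *: "ennreal (u + v) + (ennreal (- u) + ennreal (- v)) = ennreal (- (u + v)) + (ennreal u + ennreal v)"
    for u v :: real
  proof -
    have p: "ennreal z = ennreal (max z 0)" for z by (simp add: max_def ennreal_neg)
    show ?thesis
      by (subst (1 2 3 4 5 6) p) (auto simp flip: ennreal_plus simp: max_def)
  qed
  let ?n = "\<lambda>f. nn_cond_exp M F (\<lambda>x. ennreal (f x))"
  let ?Z = "\<lambda>x. X x + Y x"
  have 1: "AE x in M. ?n ?Z x + nn_cond_exp M F (\<lambda>x. ennreal (- X x) + ennreal (- Y x)) x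
     = nn_cond_exp M F (\<lambda>x. ennreal (?Z x) + (ennreal (- X x) + ennreal (- Y x))) x"
    by (rule nn_cond_exp_sum) auto
  have 2: "AE x in M. ?n (\<lambda>x. - ?Z x) x + nn_cond_exp M F (\<lambda>x. ennreal (X x) + ennreal (Y x)) x
     = nn_cond_exp M F (\<lambda>x. ennreal (?Z x) + (ennreal (- X x) + ennreal (- Y x))) x"
    unfolding * by (rule nn_cond_exp_sum) auto
  have 3: "AE x in M. ?n (\<lambda>x. - X x) x + ?n (\<lambda>x. - Y x) x = nn_cond_exp M F (\<lambda>x. ennreal (- X x) + ennreal (- Y x)) x"
    by (rule nn_cond_exp_sum) auto
  have 4: "AE x in M. ?n X x + ?n Y x = nn_cond_exp M F (\<lambda>x. ennreal (X x) + ennreal (Y x)) x"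
    by (rule nn_cond_exp_sum) auto
  show "AE x in M. real_cond_exp M F ?Z x = real_cond_exp M F X x + real_cond_exp M F Y x"
    using 1 2 3 4 cond_integrableD(2,3)[OF X] cond_integrableD(2,3)[OF Y] cond_integrableD(2,3)[OF XY]
  proof eventually_elim
    case (elim x)
    have e: "?n ?Z x + (?n (\<lambda>x. - X x) x + ?n (\<lambda>x. - Y x) x) = ?n (\<lambda>x. - ?Z x) x + (?n X x + ?n Y x)"
      using elim(1-4) by simp
    have "enn2real (?n ?Z x) + (enn2real (?n (\<lambda>x. - X x) x) + enn2real (?n (\<lambda>x. - Y x) x))
       = enn2real (?n (\<lambda>x. - ?Z x) x) + (enn2real (?n X x) + enn2real (?n Y x))"
      using arg_cong[OF e, of enn2real] elim(5-) by (simp add: enn2real_plus)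
    then show ?case unfolding real_cond_exp_def by simp
  qed
qed

lemma real_cond_exp_nonneg:
  assumes [measurable]: "X \<in> borel_measurable M" and "AE x in M. 0 \<le> X x"
  shows "AE x in M. real_cond_exp M F X x = enn2real (nn_cond_exp M F (\<lambda>x. ennreal (X x)) x)"
proof -
  have "AE x in M. nn_cond_exp M F (\<lambda>x. ennreal (- X x)) x = nn_cond_exp M F (\<lambda>x. 0) x"
    using assms(2) by (intro nn_cond_exp_cong) (auto simp: ennreal_neg)
  moreover have "AE x in M. 0 = nn_cond_exp M F (\<lambda>x. 0) x"
    by (rule nn_cond_exp_F_meas) simp
  ultimately show ?thesis unfolding real_cond_exp_def by eventually_elim (metis diff_zero enn2real_0)
qed

lemma nn_cond_exp_eq_real_cond_exp:
  assumes X: "cond_integrable M F X" and pos: "AE x in M. 0 \<le> X x"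
  shows "AE x in M. nn_cond_exp M F (\<lambda>x. ennreal (X x)) x = ennreal (real_cond_exp M F X x)"
  using real_cond_exp_nonneg[OF cond_integrableD(1)[OF X] pos] cond_integrableD(2)[OF X]
  by eventually_elim simp

text \<open>The form in which the pricing equations are computed: \<open>a\<close> collects the
  factors known today, \<open>X\<close> the growth factors of the next date. The right side is a
  real number, so finiteness of the price comes along.\<close>

lemma nn_cond_exp_mult_real:
  assumes Z: "AE x in M. Z x = a x * X x" and [measurable]: "Z \<in> borel_measurable M"
    and X: "cond_integrable M F X" and pos: "AE x in M. 0 \<le> X x"
    and aF[measurable]: "a \<in> borel_measurable F" and a: "AE x in M. 0 \<le> a x"
  shows "AE x in M. nn_cond_exp M F (\<lambda>x. ennreal (Z x)) x = ennreal (a x * real_cond_exp M F X x)"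
proof -
  note [measurable] = cond_integrableD(1)[OF X] measurable_from_subalg[OF subalg aF]
  have "AE x in M. ennreal (Z x) = ennreal (a x) * ennreal (X x)"
    using Z pos a by eventually_elim (simp add: ennreal_mult)
  then have "AE x in M. nn_cond_exp M F (\<lambda>x. ennreal (Z x)) x = nn_cond_exp M F (\<lambda>x. ennreal (a x) * ennreal (X x)) x"
    by (rule nn_cond_exp_cong) measurable
  moreover have "AE x in M. ennreal (a x) * nn_cond_exp M F (\<lambda>x. ennreal (X x)) x
      = nn_cond_exp M F (\<lambda>x. ennreal (a x) * ennreal (X x)) x"
    by (rule nn_cond_exp_prod) auto
  ultimately show ?thesis
    using nn_cond_exp_eq_real_cond_exp[OF X pos] real_cond_exp_pos[OF pos cond_integrableD(1)[OF X]] a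
    by eventually_elim (auto simp: ennreal_mult)
qed

text \<open>The factor \<open>a\<close> may change sign, as utility differences do. Its two parts
  and those of \<open>X\<close> give four products, and from each the part of \<open>a\<close> can
  be pulled out.\<close>

lemma cond_integrable_mult:
  assumes X: "cond_integrable M F X" and [measurable]: "a \<in> borel_measurable F"
  shows "cond_integrable M F (\<lambda>x. a x * X x)"
    "AE x in M. real_cond_exp M F (\<lambda>x. a x * X x) x = a x * real_cond_exp M F X x"
proof -
  note [measurable] = cond_integrableD(1)[OF X] measurable_from_subalg[OF subalg assms(2)]
  have "AE x in M. ennreal \<bar>a x\<bar> * nn_cond_exp M F (\<lambda>x. ennreal \<bar>X x\<bar>) x
      = nn_cond_exp M F (\<lambda>x. ennreal \<bar>a x\<bar> * ennreal \<bar>X x\<bar>) x"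
    by (rule nn_cond_exp_prod) auto
  moreover have "AE x in M. nn_cond_exp M F (\<lambda>x. ennreal \<bar>X x\<bar>) x < \<infinity>"
    using X by (simp add: cond_integrable_def)
  ultimately have "AE x in M. nn_cond_exp M F (\<lambda>x. ennreal \<bar>a x\<bar> * ennreal \<bar>X x\<bar>) x < \<infinity>"
    by eventually_elim (metis ennreal_less_top ennreal_mult_less_top infinity_ennreal_def)
  then show aX: "cond_integrable M F (\<lambda>x. a x * X x)"
    unfolding cond_integrable_def by (simp add: abs_mult ennreal_mult)
  let ?n = "\<lambda>f. nn_cond_exp M F (\<lambda>x. ennreal (f x))"
  \<comment> \<open>The positive part of a product is made of the two products of like parts, the
    negative part of the two mixed ones; the identity is cleared of subtraction.\<close>
  have split: "ennreal (r * v) + (ennreal (- r) * ennreal v + ennreal r * ennreal (- v))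
     = ennreal (- (r * v)) + (ennreal r * ennreal v + ennreal (- r) * ennreal (- v))" for r v :: real
    by (cases "r \<ge> 0"; cases "v \<ge> 0")
       (auto simp: ennreal_neg mult_nonneg_nonpos mult_nonpos_nonneg mult_nonpos_nonpos simp flip: ennreal_mult)
  have 1: "AE x in M. ?n (\<lambda>x. a x * X x) x
      + nn_cond_exp M F (\<lambda>x. ennreal (- a x) * ennreal (X x) + ennreal (a x) * ennreal (- X x)) x
     = nn_cond_exp M F (\<lambda>x. ennreal (a x * X x) + (ennreal (- a x) * ennreal (X x) + ennreal (a x) * ennreal (- X x))) x"
    by (rule nn_cond_exp_sum) auto
  have 2: "AE x in M. ?n (\<lambda>x. - (a x * X x)) x
      + nn_cond_exp M F (\<lambda>x. ennreal (a x) * ennreal (X x) + ennreal (- a x) * ennreal (- X x)) x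
     = nn_cond_exp M F (\<lambda>x. ennreal (a x * X x) + (ennreal (- a x) * ennreal (X x) + ennreal (a x) * ennreal (- X x))) x"
    unfolding split by (rule nn_cond_exp_sum) auto
  have 3: "AE x in M. nn_cond_exp M F (\<lambda>x. ennreal (- a x) * ennreal (X x)) x
      + nn_cond_exp M F (\<lambda>x. ennreal (a x) * ennreal (- X x)) x
     = nn_cond_exp M F (\<lambda>x. ennreal (- a x) * ennreal (X x) + ennreal (a x) * ennreal (- X x)) x"
    by (rule nn_cond_exp_sum) auto
  have 4: "AE x in M. nn_cond_exp M F (\<lambda>x. ennreal (a x) * ennreal (X x)) x
      + nn_cond_exp M F (\<lambda>x. ennreal (- a x) * ennreal (- X x)) x
     = nn_cond_exp M F (\<lambda>x. ennreal (a x) * ennreal (X x) + ennreal (- a x) * ennreal (- X x)) x"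
    by (rule nn_cond_exp_sum) auto
  have P: "AE x in M. ennreal (r x) * ?n V x = nn_cond_exp M F (\<lambda>x. ennreal (r x) * ennreal (V x)) x"
    if [measurable]: "r \<in> borel_measurable F" "V \<in> borel_measurable M" for r V
    by (rule nn_cond_exp_prod) auto
  have XM: "X \<in> borel_measurable M" and mXM: "(\<lambda>x. - X x) \<in> borel_measurable M"
    and maM: "(\<lambda>x. - a x) \<in> borel_measurable F"
    by measurable
  show "AE x in M. real_cond_exp M F (\<lambda>x. a x * X x) x = a x * real_cond_exp M F X x"
    using 1 2 3 4 P[OF assms(2) XM] P[OF maM XM] P[OF assms(2) mXM] P[OF maM mXM]
      cond_integrableD(2,3)[OF X] cond_integrableD(2,3)[OF aX]
  proof eventually_elim
    case (elim x)
    have e: "?n (\<lambda>x. a x * X x) x + (ennreal (- a x) * ?n X x + ennreal (a x) * ?n (\<lambda>x. - X x) x)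
      = ?n (\<lambda>x. - (a x * X x)) x + (ennreal (a x) * ?n X x + ennreal (- a x) * ?n (\<lambda>x. - X x) x)"
      using elim(1-8) by simp
    have "enn2real (?n (\<lambda>x. a x * X x) x) +
        (enn2real (ennreal (- a x)) * enn2real (?n X x) + enn2real (ennreal (a x)) * enn2real (?n (\<lambda>x. - X x) x))
      = enn2real (?n (\<lambda>x. - (a x * X x)) x) +
        (enn2real (ennreal (a x)) * enn2real (?n X x) + enn2real (ennreal (- a x)) * enn2real (?n (\<lambda>x. - X x) x))"
      using arg_cong[OF e, of enn2real] elim(9-)
      by (simp add: enn2real_plus enn2real_mult ennreal_mult_less_top)
    then show ?case unfolding real_cond_exp_def
      by (cases "a x \<ge> 0") (auto simp: ennreal_neg algebra_simps)
  qed
qed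

lemma cond_integrable_mono:
  assumes X: "cond_integrable M F X" and Y: "cond_integrable M F Y" and le: "AE x in M. X x \<le> Y x"
  shows "AE x in M. real_cond_exp M F X x \<le> real_cond_exp M F Y x"
proof -
  note [measurable] = cond_integrableD(1)[OF X] cond_integrableD(1)[OF Y]
  have "AE x in M. nn_cond_exp M F (\<lambda>x. ennreal (X x)) x \<le> nn_cond_exp M F (\<lambda>x. ennreal (Y x)) x"
    using le by (intro nn_cond_exp_mono) (auto intro: ennreal_leI)
  moreover have "AE x in M. nn_cond_exp M F (\<lambda>x. ennreal (- Y x)) x \<le> nn_cond_exp M F (\<lambda>x. ennreal (- X x)) x"
    using le by (intro nn_cond_exp_mono) (auto elim!: eventually_mono intro: ennreal_leI)
  \<comment> \<open>\<open>enn2real\<close> sends infinity to \<open>0\<close>, so it is monotone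
    only where the larger side is finite.\<close>
  ultimately show ?thesis
    using cond_integrableD(2)[OF Y] cond_integrableD(3)[OF X]
    unfolding real_cond_exp_def
    by eventually_elim (auto intro!: diff_mono enn2real_mono)
qed

end

section \<open>Conditioning in the presence of an independent variable\<close>

context prob_space
begin

lemma sigma_finite_subalgebraI:
  assumes "subalgebra M G"
  shows "sigma_finite_subalgebra M G"
  using assms
  by (intro finite_measure_subalgebra_is_sigma_finite finite_measure_subalgebra.intro)
     (auto simp: finite_measure_subalgebra_axioms_def finite_measure_axioms)

text \<open>Independence makes the joint law of \<open>Y\<close> and the identity into
  \<open>G\<close> a product, so by Tonelli \<open>Y\<close> is integrated out with \<omega> held
  fixed. This freezing rule evaluates the conditional laws of growth and of its independent
  copies.\<close>

lemma nn_cond_exp_freeze: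
  assumes sub: "subalgebra M G"
    and Y[measurable]: "Y \<in> borel_measurable M"
    and ind: "indep_set (sets (vimage_algebra (space M) Y borel)) (sets G)"
    and f[measurable]: "(\<lambda>(\<omega>, y). f \<omega> y) \<in> borel_measurable (G \<Otimes>\<^sub>M (borel :: real measure))"
  shows "AE \<omega> in M. nn_cond_exp M G (\<lambda>\<omega>. f \<omega> (Y \<omega>)) \<omega> = (\<integral>\<^sup>+ y. f \<omega> y \<partial>distr M borel Y)"
proof -
  interpret sigma_finite_subalgebra M G by (rule sigma_finite_subalgebraI[OF sub])
  have sp: "space G = space M" and sets: "sets G \<subseteq> sets M" using sub by (auto simp: subalgebra_def)
  \<comment> \<open>Seen as a map from \<open>M\<close> to the coarser \<open>G\<close>, the
    identity has the restriction of \<open>M\<close> to \<open>G\<close> as its law.\<close>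
  have id[measurable]: "(\<lambda>\<omega>. \<omega>) \<in> measurable M G"
    using sub by (auto simp: subalgebra_def measurable_def sets.Int_space_eq2 subset_eq intro!: sets.Int)
  interpret Y: prob_space "distr M borel Y" by (rule prob_space_distr) simp
  interpret I: prob_space "distr M G (\<lambda>\<omega>. \<omega>)" by (rule prob_space_distr) simp
  interpret P: pair_sigma_finite "distr M borel Y" "distr M G (\<lambda>\<omega>. \<omega>)" ..
  have prod: "distr M borel Y \<Otimes>\<^sub>M distr M G (\<lambda>\<omega>. \<omega>) = distr M (borel \<Otimes>\<^sub>M G) (\<lambda>\<omega>. (Y \<omega>, \<omega>))"
  proof (rule pair_measure_eqI)
    fix A B assume AB: "A \<in> sets (distr M borel Y)" "B \<in> sets (distr M G (\<lambda>\<omega>. \<omega>))"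
    then have [measurable]: "A \<in> sets borel" "B \<in> sets G" by auto
    have B: "B \<subseteq> space M" using sets.sets_into_space[of B G] sp by simp
    have "Y -` A \<inter> space M \<in> sets (vimage_algebra (space M) Y borel)"
      by (intro in_vimage_algebra) simp
    then have "prob ((Y -` A \<inter> space M) \<inter> B) = prob (Y -` A \<inter> space M) * prob B"
      using ind by (auto simp: indep_sets2_eq)
    moreover have "(\<lambda>\<omega>. (Y \<omega>, \<omega>)) -` (A \<times> B) \<inter> space M = (Y -` A \<inter> space M) \<inter> B"
      using B by auto
    ultimately show "emeasure (distr M borel Y) A * emeasure (distr M G (\<lambda>\<omega>. \<omega>)) B
        = emeasure (distr M (borel \<Otimes>\<^sub>M G) (\<lambda>\<omega>. (Y \<omega>, \<omega>))) (A \<times> B)"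
      using B by (simp add: emeasure_distr emeasure_eq_measure Int_absorb2 flip: ennreal_mult)
  next
    show "sigma_finite_measure (distr M borel Y)" by (rule Y.sigma_finite_measure_axioms)
    show "sigma_finite_measure (distr M G (\<lambda>\<omega>. \<omega>))" by (rule I.sigma_finite_measure_axioms)
    have "sets (distr M borel Y \<Otimes>\<^sub>M distr M G (\<lambda>\<omega>. \<omega>)) = sets (borel \<Otimes>\<^sub>M G)"
      by (rule sets_pair_measure_cong) auto
    then show "sets (distr M borel Y \<Otimes>\<^sub>M distr M G (\<lambda>\<omega>. \<omega>)) = sets (distr M (borel \<Otimes>\<^sub>M G) (\<lambda>\<omega>. (Y \<omega>, \<omega>)))"
      by (simp only: sets_distr)
  qed
  have f2[measurable]: "(\<lambda>(y, \<omega>). f \<omega> y) \<in> borel_measurable (borel \<Otimes>\<^sub>M G)"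
    using measurable_compose[OF measurable_pair_swap' f] by (simp add: case_prod_beta')
  have "(\<lambda>\<omega>. (\<omega>, Y \<omega>)) \<in> measurable M (G \<Otimes>\<^sub>M borel)" by measurable
  from measurable_compose[OF this f] have fY[measurable]: "(\<lambda>\<omega>. f \<omega> (Y \<omega>)) \<in> borel_measurable M" by simp
  have gm[measurable]: "(\<lambda>\<omega>. \<integral>\<^sup>+ y. f \<omega> y \<partial>distr M borel Y) \<in> borel_measurable G"
    by (rule Y.borel_measurable_nn_integral) (simp add: f cong: measurable_cong_sets)
  have "AE \<omega> in M. (\<integral>\<^sup>+ y. f \<omega> y \<partial>distr M borel Y) = nn_cond_exp M G (\<lambda>\<omega>. f \<omega> (Y \<omega>)) \<omega>"
  proof (rule nn_cond_exp_charact)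
    fix B assume B[measurable]: "B \<in> sets G"
    have "(\<integral>\<^sup>+ \<omega>\<in>B. f \<omega> (Y \<omega>) \<partial>M) = (\<integral>\<^sup>+ z. f (snd z) (fst z) * indicator B (snd z) \<partial>distr M (borel \<Otimes>\<^sub>M G) (\<lambda>\<omega>. (Y \<omega>, \<omega>)))"
      using f2 by (subst nn_integral_distr) (auto simp: case_prod_beta')
    also have "\<dots> = (\<integral>\<^sup>+ \<omega>. (\<integral>\<^sup>+ y. f \<omega> y * indicator B \<omega> \<partial>distr M borel Y) \<partial>distr M G (\<lambda>\<omega>. \<omega>))"
      unfolding prod[symmetric] using f2
      by (subst P.nn_integral_snd[symmetric]) (auto simp: case_prod_beta')
    also have "\<dots> = (\<integral>\<^sup>+ \<omega>. (\<integral>\<^sup>+ y. f \<omega> y \<partial>distr M borel Y) * indicator B \<omega> \<partial>distr M G (\<lambda>\<omega>. \<omega>))"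
      by (rule nn_integral_cong) (auto simp: indicator_def)
    also have "\<dots> = (\<integral>\<^sup>+ \<omega>\<in>B. (\<integral>\<^sup>+ y. f \<omega> y \<partial>distr M borel Y) \<partial>M)"
      by (subst nn_integral_distr) auto
    finally show "(\<integral>\<^sup>+ \<omega>\<in>B. f \<omega> (Y \<omega>) \<partial>M) = (\<integral>\<^sup>+ \<omega>\<in>B. (\<integral>\<^sup>+ y. f \<omega> y \<partial>distr M borel Y) \<partial>M)" .
  qed auto
  then show ?thesis by auto
qed

end

section \<open>Utility and information\<close>

text \<open>Homogeneity of power utility, additivity for the logarithm. It separates the known past
  level from the random growth factor.\<close>

lemma crra_mult:
  assumes "p > 0" "y > 0"
  shows "crra \<theta> (p * y) = p powr (1 - \<theta>) * crra \<theta> y + (if \<theta> = 1 then ln p else 0)"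
  using assms by (auto simp: crra_def ln_mult powr_mult)

lemma crra_measurable [measurable]: "crra \<theta> \<in> borel_measurable borel"
  unfolding crra_def[abs_def] by measurable

text \<open>The derivative is decreasing, so on either side of \<open>x\<close> the mean value
  theorem compares its value at the intermediate point with that at \<open>x\<close>.\<close>

lemma crra_le_tangent:
  assumes \<theta>: "\<theta> > 0" and x: "x > 0" and y: "y > 0"
  shows "crra \<theta> y \<le> crra \<theta> x + x powr (- \<theta>) * (y - x)"
proof -
  have D: "(crra \<theta> has_real_derivative z powr (- \<theta>)) (at z)" if "z > 0" for z
  proof (cases "\<theta> = 1")
    case True
    have "(ln has_real_derivative 1 / z) (at z)" using that by (auto intro!: derivative_eq_intros)
    then show ?thesis using True that by (simp add: crra_def[abs_def] powr_minus_divide)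
  next
    case False
    have "((\<lambda>x. x powr (1 - \<theta>) / (1 - \<theta>)) has_real_derivative z powr (- \<theta>)) (at z)"
      using that False by (auto intro!: derivative_eq_intros)
    then show ?thesis using False by (simp add: crra_def[abs_def])
  qed
  show ?thesis
  proof (cases x y rule: linorder_cases)
    case less
    from MVT2[OF less, of "crra \<theta>" "\<lambda>z. z powr (- \<theta>)"] D x
    obtain z where z: "x < z" "z < y" "crra \<theta> y - crra \<theta> x = (y - x) * z powr (- \<theta>)" by auto
    have "z powr (- \<theta>) \<le> x powr (- \<theta>)" using \<theta> x z by (intro powr_mono2') auto
    with z less show ?thesis by (auto simp: algebra_simps dest: mult_left_mono[of _ _ "y - x"])
  next
    case greater
    from MVT2[OF greater, of "crra \<theta>" "\<lambda>z. z powr (- \<theta>)"] D y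
    obtain z where z: "y < z" "z < x" "crra \<theta> x - crra \<theta> y = (x - y) * z powr (- \<theta>)" by auto
    have "x powr (- \<theta>) \<le> z powr (- \<theta>)" using \<theta> y z by (intro powr_mono2') auto
    with z greater show ?thesis by (auto simp: algebra_simps dest: mult_left_mono[of _ _ "x - y"])
  qed simp
qed

lemma crra_mono:
  assumes "\<theta> > 0" "0 < x" "x \<le> y"
  shows "crra \<theta> x \<le> crra \<theta> y"
proof -
  have "crra \<theta> x \<le> crra \<theta> y + y powr (- \<theta>) * (x - y)"
    using assms by (intro crra_le_tangent) auto
  also have "y powr (- \<theta>) * (x - y) \<le> 0" using assms by (simp add: mult_nonneg_nonpos)
  finally show ?thesis by simp
qed

text \<open>For \<open>lam \<ge> 1\<close> the function is the minimum of \<open>x\<close> and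
  \<open>lam * x\<close>, hence concave. The slope of the branch on which \<open>x\<close> lies is a
  supergradient, and at the kink both slopes are.\<close>

lemma gain_loss_le_tangent:
  assumes "lam \<ge> 1" "s = 1 \<and> 0 \<le> x \<or> s = lam \<and> x \<le> 0"
  shows "gain_loss lam z \<le> gain_loss lam x + (z - x) * s"
proof -
  have "z * lam \<le> z * 1" if "z < 0" using assms(1) that by (intro mult_left_mono_neg) auto
  moreover have "z * 1 \<le> z * lam" if "0 \<le> z" using assms(1) that by (intro mult_left_mono) auto
  ultimately show ?thesis
    using assms(2) by (auto simp: gain_loss_def algebra_simps not_le)
qed

lemma gain_loss_measurable [measurable]: "gain_loss lam \<in> borel_measurable borel"
  unfolding gain_loss_def[abs_def] by measurable

lemma abs_gain_loss_le: "lam \<ge> 1 \<Longrightarrow> \<bar>gain_loss lam x\<bar> \<le> lam * \<bar>x\<bar>"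
  by (auto simp: gain_loss_def abs_mult mult_le_cancel_right1)

lemma level_eq_prev_level: "level x0 g t \<omega> = prev_level x0 g t \<omega> * g t \<omega>"
  by (simp add: level_def prev_level_def lessThan_Suc_atMost[symmetric] mult.assoc)

lemma prev_level_Suc: "prev_level x0 g (Suc t) = level x0 g t"
  by (simp add: level_def prev_level_def lessThan_Suc_atMost fun_eq_iff)

lemma level_Suc: "level x0 g (Suc t) \<omega> = level x0 g t \<omega> * g (Suc t) \<omega>"
  by (simp add: level_eq_prev_level[of _ _ "Suc t"] prev_level_Suc)

section \<open>Information and independence of growth\<close>

context endowment_economy
begin

lemma sets_info: "sets (info M ec ed I) =
    sigma_sets (space M) {(\<lambda>\<omega>. (ec i \<omega>, ed i \<omega>)) -` B \<inter> space M | i B. i \<in> I \<and> B \<in> sets borel}"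
  and space_info [simp]: "space (info M ec ed I) = space M"
  unfolding info_def by (auto intro!: sets_measure_of space_measure_of)

lemma subalgebra_info: "subalgebra M (info M ec ed I)"
proof -
  have [measurable]: "(\<lambda>\<omega>. (ec i \<omega>, ed i \<omega>)) \<in> borel_measurable M" for i
    using ec_meas ed_meas by (intro borel_measurable_Pair)
  have "sigma_sets (space M) {(\<lambda>\<omega>. (ec i \<omega>, ed i \<omega>)) -` B \<inter> space M | i B. i \<in> I \<and> B \<in> sets borel} \<subseteq> sets M"
    by (intro sets.sigma_sets_subset) auto
  then show ?thesis by (simp add: subalgebra_def sets_info)
qed

lemma subalgebra_info_mono:
  assumes "I \<subseteq> J"
  shows "subalgebra (info M ec ed J) (info M ec ed I)"
  using assms unfolding subalgebra_def by (auto simp: sets_info intro: sigma_sets_mono'[THEN subsetD, rotated])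

lemma measurable_info:
  assumes "i \<in> I"
  shows "ec i \<in> borel_measurable (info M ec ed I)" "ed i \<in> borel_measurable (info M ec ed I)"
proof -
  have p: "(\<lambda>\<omega>. (ec i \<omega>, ed i \<omega>)) \<in> measurable (info M ec ed I) borel"
    using assms by (intro measurableI) (auto simp: sets_info intro!: sigma_sets.Basic)
  have "(fst :: real \<times> real \<Rightarrow> real) \<in> borel_measurable borel" "(snd :: real \<times> real \<Rightarrow> real) \<in> borel_measurable borel"
    by (intro borel_measurable_continuous_onI continuous_intros)+
  from measurable_compose[OF p this(1)] measurable_compose[OF p this(2)]
  show "ec i \<in> borel_measurable (info M ec ed I)" "ed i \<in> borel_measurable (info M ec ed I)" by simp_all
qed

lemma level_measurable_info:
  "level c0 ec t \<in> borel_measurable (info M ec ed {..t})"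
  "level d0 ed t \<in> borel_measurable (info M ec ed {..t})"
  unfolding level_def[abs_def]
  by (intro borel_measurable_times borel_measurable_const borel_measurable_prod measurable_info; simp)+

lemma prev_level_measurable_info:
  "prev_level c0 ec t \<in> borel_measurable (info M ec ed {..<t})"
  unfolding prev_level_def[abs_def]
  by (intro borel_measurable_times borel_measurable_const borel_measurable_prod measurable_info; simp)

lemma level_pos:
  assumes "\<omega> \<in> space M"
  shows "level c0 ec t \<omega> > 0" "level d0 ed t \<omega> > 0" "prev_level c0 ec t \<omega> > 0"
  using assms ec_pos ed_pos c0_pos d0_pos
  by (auto simp: level_def prev_level_def intro!: mult_pos_pos prod_pos)

lemma sigma_finite_info: "sigma_finite_subalgebra M (info M ec ed I)"
  by (rule sigma_finite_subalgebraI[OF subalgebra_info])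

text \<open>Before date \<open>0\<close> the information is the trivial sigma-algebra, of which
  every event is independent; at later dates this is the assumption on the past, shifted by
  one.\<close>

lemma ec_indep_prev: "indep_set (sets (vimage_algebra (space M) (ec t) borel)) (sets (info M ec ed {..<t}))"
proof (cases t)
  case 0
  have "sets (vimage_algebra (space M) (ec 0) borel) \<subseteq> sets M"
    using ec_meas[of 0] by (auto simp: sets_vimage_algebra2)
  moreover have "sets (info M ec ed {}) = {{}, space M}"
    by (simp add: sets_info sigma_sets_empty_eq)
  ultimately show ?thesis using 0
    by (auto simp: indep_sets2_eq prob_space dest!: subsetD intro: arg_cong[where f=prob] simp: sets.Int_space_eq2)
next
  case (Suc t')
  then show ?thesis using ec_indep_past[of t'] by (simp add: lessThan_Suc_atMost)
qed

lemma etil_indep_info: "indep_set (sets (vimage_algebra (space M) (etil t) borel)) (sets (info M ec ed I))"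
proof -
  have "sets (info M ec ed I) \<subseteq> sets (info M ec ed UNIV)"
    using subalgebra_info_mono[of I UNIV] by (simp add: subalgebra_def)
  then show ?thesis using etil_indep[of t] unfolding indep_sets2_eq by blast
qed

text \<open>Positivity passes through the common law with \<open>ec 0\<close>, so it is obtained
  almost everywhere.\<close>

lemma etil_pos: "AE \<omega> in M. etil t \<omega> > 0"
proof -
  note [measurable] = ec_meas etil_meas
  have "AE x in distr M borel (ec 0). x > 0"
    using ec_pos[of _ 0] by (subst AE_distr_iff) auto
  then have "AE x in distr M borel (etil t). x > 0" by (simp only: etil_ident)
  then show ?thesis by (subst (asm) AE_distr_iff) auto
qed

section \<open>Reference points and their conditional law\<close>

definition reference :: "nat \<Rightarrow> 'a \<Rightarrow> real" where
  "reference t \<omega> = prev_level c0 ec t \<omega> * etil t \<omega>"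

lemma reference_measurable [measurable]: "reference t \<in> borel_measurable M"
  unfolding reference_def[abs_def]
  using measurable_from_subalg[OF subalgebra_info prev_level_measurable_info] etil_meas by measurable

text \<open>The right side is the same for every \<open>I\<close> containing the dates before
  \<open>t\<close>: \<open>etil t\<close> is independent of all information and the past level is
  already known. Comparing the smallest and the largest \<open>I\<close> gives conditional
  independence.\<close>

lemma nn_cond_exp_reference:
  assumes B[measurable]: "B \<in> sets borel"
    and I: "{..<t} \<subseteq> I"
  shows "AE \<omega> in M. nn_cond_exp M (info M ec ed I) (\<lambda>\<omega>. indicator B (reference t \<omega>)) \<omega>
      = (\<integral>\<^sup>+ y. indicator B (prev_level c0 ec t \<omega> * y) \<partial>distr M borel (ec 0))"
proof -
  have [measurable]: "prev_level c0 ec t \<in> borel_measurable (info M ec ed I)"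
    by (rule measurable_from_subalg[OF subalgebra_info_mono[OF I] prev_level_measurable_info])
  show ?thesis
    unfolding reference_def etil_ident[of t, symmetric]
    by (rule nn_cond_exp_freeze[OF subalgebra_info etil_meas etil_indep_info]) measurable
qed

text \<open>Under the terminal information the reference point hits \<open>B\<close> with
  conditional probability \<open>\<phi>\<close>, which is already known before date
  \<open>t\<close>. Conditioning on the terminal information first therefore lets
  \<open>\<phi>\<close> leave the expectation and only the indicator of \<open>K\<close> stays
  inside.\<close>

lemma cond_indep_reference:
  "cond_indep M (info M ec ed {..<t}) (reference t) (info M ec ed UNIV)"
  unfolding cond_indep_def
proof (intro ballI)
  fix B :: "real set" and K assume B[measurable]: "B \<in> sets borel" and K: "K \<in> sets (info M ec ed UNIV)"
  let ?G = "info M ec ed {..<t}" and ?H = "info M ec ed UNIV"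
  define \<phi> where "\<phi> \<omega> = (\<integral>\<^sup>+ y. indicator B (prev_level c0 ec t \<omega> * y) \<partial>distr M borel (ec 0))" for \<omega>
  interpret G: sigma_finite_subalgebra M ?G by (rule sigma_finite_info)
  interpret H: sigma_finite_subalgebra M ?H by (rule sigma_finite_info)
  interpret distr: prob_space "distr M borel (ec 0)" by (rule prob_space_distr[OF ec_meas])
  note [measurable] = prev_level_measurable_info[of t]
  have \<phi>G[measurable]: "\<phi> \<in> borel_measurable ?G" unfolding \<phi>_def[abs_def] by measurable
  then have [measurable]: "\<phi> \<in> borel_measurable M" by (rule measurable_from_subalg[OF subalgebra_info])
  have KM[measurable]: "K \<in> sets M" using K subalgebra_info[of UNIV] by (auto simp: subalgebra_def)
  have 1: "AE \<omega> in M. nn_cond_exp M ?G (\<lambda>\<omega>. indicator B (reference t \<omega>)) \<omega> = \<phi> \<omega>"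
    unfolding \<phi>_def by (rule nn_cond_exp_reference) auto
  have 2: "AE \<omega> in M. nn_cond_exp M ?H (\<lambda>\<omega>. indicator B (reference t \<omega>)) \<omega> = \<phi> \<omega>"
    unfolding \<phi>_def by (rule nn_cond_exp_reference) auto
  have 3: "AE \<omega> in M. indicator K \<omega> * nn_cond_exp M ?H (\<lambda>\<omega>. indicator B (reference t \<omega>)) \<omega>
      = nn_cond_exp M ?H (\<lambda>\<omega>. indicator K \<omega> * indicator B (reference t \<omega>)) \<omega>"
    using K by (intro H.nn_cond_exp_prod) auto
  have "AE \<omega> in M. nn_cond_exp M ?G (\<lambda>\<omega>. indicator K \<omega> * indicator B (reference t \<omega>)) \<omega>
      = nn_cond_exp M ?G (nn_cond_exp M ?H (\<lambda>\<omega>. indicator K \<omega> * indicator B (reference t \<omega>))) \<omega>"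
    by (rule G.nn_cond_exp_nested_subalg) (auto simp: subalgebra_info subalgebra_info_mono)
  moreover have "AE \<omega> in M. nn_cond_exp M ?G (nn_cond_exp M ?H (\<lambda>\<omega>. indicator K \<omega> * indicator B (reference t \<omega>))) \<omega>
      = nn_cond_exp M ?G (\<lambda>\<omega>. \<phi> \<omega> * indicator K \<omega>) \<omega>"
    using 2 3 by (intro G.nn_cond_exp_cong) (auto simp: mult.commute elim!: eventually_elim2)
  moreover have "AE \<omega> in M. \<phi> \<omega> * nn_cond_exp M ?G (indicator K) \<omega> = nn_cond_exp M ?G (\<lambda>\<omega>. \<phi> \<omega> * indicator K \<omega>) \<omega>"
    by (intro G.nn_cond_exp_prod) auto
  ultimately have 4: "AE \<omega> in M. nn_cond_exp M ?G (\<lambda>\<omega>. indicator K \<omega> * indicator B (reference t \<omega>)) \<omega>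
      = \<phi> \<omega> * nn_cond_exp M ?G (indicator K) \<omega>" by auto
  have e: "ennreal (indicator X x) = indicator X x" for X and x :: 'x by (simp add: indicator_def)
  have 5: "AE \<omega> in M. real_cond_exp M ?G (\<lambda>\<omega>. indicator B (reference t \<omega>) * indicator K \<omega>) \<omega>
      = enn2real (nn_cond_exp M ?G (\<lambda>\<omega>. indicator K \<omega> * indicator B (reference t \<omega>)) \<omega>)"
    using G.real_cond_exp_nonneg[of "\<lambda>\<omega>. indicator B (reference t \<omega>) * indicator K \<omega>"]
    by (simp add: ennreal_mult e mult.commute)
  have 6: "AE \<omega> in M. real_cond_exp M ?G (\<lambda>\<omega>. indicator B (reference t \<omega>)) \<omega>
      = enn2real (nn_cond_exp M ?G (\<lambda>\<omega>. indicator B (reference t \<omega>)) \<omega>)"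
    using G.real_cond_exp_nonneg[of "\<lambda>\<omega>. indicator B (reference t \<omega>)"] by (simp add: e)
  have 7: "AE \<omega> in M. real_cond_exp M ?G (indicator K) \<omega> = enn2real (nn_cond_exp M ?G (indicator K) \<omega>)"
    using G.real_cond_exp_nonneg[of "indicator K"] by (simp add: e)
  show "AE \<omega> in M. real_cond_exp M ?G (\<lambda>\<omega>. indicator B (reference t \<omega>) * indicator K \<omega>) \<omega>
      = real_cond_exp M ?G (\<lambda>\<omega>. indicator B (reference t \<omega>)) \<omega> * real_cond_exp M ?G (indicator K) \<omega>"
    using 1 4 5 6 7 by eventually_elim (simp add: enn2real_mult)
qed

text \<open>Consumption and reference point are one and the same past level times growth factors
  that have a common law and are independent of the past, so freezing gives the same integral for
  both.\<close>

lemma cond_ident_distr_reference: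
  "cond_ident_distr M (info M ec ed {..<t}) (reference t) (level c0 ec t)"
  unfolding cond_ident_distr_def
proof
  fix B :: "real set" assume B[measurable]: "B \<in> sets borel"
  let ?G = "info M ec ed {..<t}"
  interpret G: sigma_finite_subalgebra M ?G by (rule sigma_finite_info)
  note [measurable] = prev_level_measurable_info[of t] ec_meas
    measurable_from_subalg[OF subalgebra_info level_measurable_info(1)[of t]]
  have 1: "AE \<omega> in M. nn_cond_exp M ?G (\<lambda>\<omega>. indicator B (level c0 ec t \<omega>)) \<omega>
      = (\<integral>\<^sup>+ y. indicator B (prev_level c0 ec t \<omega> * y) \<partial>distr M borel (ec 0))"
    unfolding level_eq_prev_level ec_ident[of t, symmetric]
    by (rule nn_cond_exp_freeze[OF subalgebra_info ec_meas ec_indep_prev]) measurable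
  have 2: "AE \<omega> in M. nn_cond_exp M ?G (\<lambda>\<omega>. indicator B (reference t \<omega>)) \<omega>
      = (\<integral>\<^sup>+ y. indicator B (prev_level c0 ec t \<omega> * y) \<partial>distr M borel (ec 0))"
    by (rule nn_cond_exp_reference) auto
  have e: "ennreal (indicator X x) = indicator X x" for X and x :: 'x by (simp add: indicator_def)
  have 3: "AE \<omega> in M. real_cond_exp M ?G (\<lambda>\<omega>. indicator B (X \<omega>)) \<omega>
      = enn2real (nn_cond_exp M ?G (\<lambda>\<omega>. indicator B (X \<omega>)) \<omega>)"
    if [measurable]: "X \<in> borel_measurable M" for X
    using G.real_cond_exp_nonneg[of "\<lambda>\<omega>. indicator B (X \<omega>)"] by (simp add: e)
  show "AE \<omega> in M. real_cond_exp M ?G (\<lambda>\<omega>. indicator B (reference t \<omega>)) \<omega>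
      = real_cond_exp M ?G (\<lambda>\<omega>. indicator B (level c0 ec t \<omega>)) \<omega>"
    using 1 2 3[of "reference t"] 3[of "level c0 ec t"] by auto
qed

end

section \<open>The pricing kernel\<close>

locale gain_loss_economy = endowment_economy M c0 d0 ec ed etil
  for M :: "'a measure" and c0 d0 :: real and ec ed etil :: "nat \<Rightarrow> 'a \<Rightarrow> real" +
  fixes \<theta> \<beta> b lam :: real
  assumes \<theta>_pos: "\<theta> > 0" and \<beta>_pos: "\<beta> > 0" and b_nonneg: "b \<ge> 0" and lam_ge: "lam \<ge> 1"
    and crra_integrable: "integrable M (\<lambda>\<omega>. crra \<theta> (ec 0 \<omega>))"
    and powr_integrable: "integrable M (\<lambda>\<omega>. ec 0 \<omega> powr (- \<theta>))"
    and growth_cond_integrable: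
      "\<And>t. cond_integrable M (info M ec ed {..t}) (\<lambda>\<omega>. ec (Suc t) \<omega> powr (- \<theta>) * ed (Suc t) \<omega>)"
begin

abbreviation \<F> :: "nat \<Rightarrow> 'a measure" where "\<F> t \<equiv> info M ec ed {..t}"
abbreviation Cbar :: "nat \<Rightarrow> 'a \<Rightarrow> real" where "Cbar \<equiv> level c0 ec"
abbreviation Div :: "nat \<Rightarrow> 'a \<Rightarrow> real" where "Div \<equiv> level d0 ed"

definition Feps :: "real \<Rightarrow> real" where "Feps = cdf (distr M borel (ec 0))"
definition A :: "real \<Rightarrow> real" where "A x = 1 + b * Feps x + b * lam * (1 - Feps x)"
definition k :: "nat \<Rightarrow> 'a \<Rightarrow> real" where
  "k t = real_cond_exp M (\<F> t) (\<lambda>\<omega>. ec (Suc t) \<omega> powr (- \<theta>) * ed (Suc t) \<omega>)"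
definition h :: "nat \<Rightarrow> 'a \<Rightarrow> real" where
  "h t = real_cond_exp M (\<F> t) (\<lambda>\<omega>. ec (Suc t) \<omega> powr (- \<theta>) * ed (Suc t) \<omega> * A (ec (Suc t) \<omega>))"
text \<open>The price-dividend ratio multiplied by the current \<open>A (ec t)\<close>, so that only
  the conditional moments of next-period growth are left in it.\<close>

definition q :: "nat \<Rightarrow> 'a \<Rightarrow> real" where "q t \<omega> = \<beta> * h t \<omega> / (1 - \<beta> * k t \<omega>)"
definition K :: real where "K = (\<integral>\<omega>. ec 0 \<omega> powr (- \<theta>) * A (ec 0 \<omega>) \<partial>M)"
definition Q :: "nat \<Rightarrow> 'a \<Rightarrow> real" where "Q t \<omega> = A (ec t \<omega>) * Cbar t \<omega> powr (- \<theta>)"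
definition Rf :: "nat \<Rightarrow> 'a \<Rightarrow> real" where "Rf t \<omega> = A (ec t \<omega>) / (\<beta> * K)"
definition S :: "nat \<Rightarrow> 'a \<Rightarrow> real" where "S t \<omega> = Div t \<omega> * q t \<omega> / A (ec t \<omega>)"

abbreviation utility :: "(nat \<Rightarrow> 'a \<Rightarrow> real) \<Rightarrow> nat \<Rightarrow> 'a \<Rightarrow> real" where
  "utility C s \<equiv> period_utility M (\<F> s) \<theta> b lam (reference s) (C s)"

section \<open>Bounds, measurability and moments for the supergradient\<close>

lemma Feps_eq: "Feps x = measure (distr M borel (ec t)) {..x}"
  unfolding Feps_def cdf_def ec_ident[of t] ..

lemma Feps_range: "0 \<le> Feps x" "Feps x \<le> 1"
proof -
  interpret d: prob_space "distr M borel (ec 0)" by (rule prob_space_distr[OF ec_meas])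
  show "0 \<le> Feps x" "Feps x \<le> 1" by (simp_all add: Feps_eq[of _ 0])
qed

text \<open>\<open>A x\<close> is \<open>1\<close> plus \<open>b\<close> times a mean of the slopes
  \<open>1\<close> and \<open>lam\<close> with weights \<open>Feps x\<close> and
  \<open>1 - Feps x\<close>; the two products in the proof are its distances from the extreme
  values.\<close>

lemma A_bounds: "1 + b \<le> A x" "A x \<le> 1 + b * lam" "0 < A x"
proof -
  have "0 \<le> b * (lam - 1) * (1 - Feps x)" "0 \<le> b * (lam - 1) * Feps x"
    using Feps_range b_nonneg lam_ge by (auto intro!: mult_nonneg_nonneg)
  then show "1 + b \<le> A x" "A x \<le> 1 + b * lam" by (auto simp: A_def algebra_simps)
  then show "0 < A x" using b_nonneg by linarith
qed

lemma A_measurable [measurable]: "A \<in> borel_measurable borel"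
  unfolding A_def[abs_def] Feps_def using ec_cdf
  by (intro borel_measurable_continuous_onI continuous_intros)

lemma measurable_\<F> [measurable]:
  "ec t \<in> borel_measurable (\<F> t)" "Cbar t \<in> borel_measurable (\<F> t)" "Div t \<in> borel_measurable (\<F> t)"
  by (auto intro: measurable_info level_measurable_info)

lemma measurable_M [measurable]:
  "ec t \<in> borel_measurable M" "ed t \<in> borel_measurable M" "etil t \<in> borel_measurable M"
  "Cbar t \<in> borel_measurable M" "Div t \<in> borel_measurable M"
  using ec_meas ed_meas etil_meas measurable_from_subalg[OF subalgebra_info level_measurable_info(1)]
    measurable_from_subalg[OF subalgebra_info level_measurable_info(2)] by auto

lemma measurable_\<F>_M: "f \<in> borel_measurable (\<F> t) \<Longrightarrow> f \<in> borel_measurable M"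
  by (rule measurable_from_subalg[OF subalgebra_info])

lemma asset_measurable [measurable]:
  "k t \<in> borel_measurable (\<F> t)" "h t \<in> borel_measurable (\<F> t)" "q t \<in> borel_measurable (\<F> t)"
  "Q t \<in> borel_measurable (\<F> t)" "Rf t \<in> borel_measurable (\<F> t)" "S t \<in> borel_measurable (\<F> t)"
proof -
  show [measurable]: "k t \<in> borel_measurable (\<F> t)" "h t \<in> borel_measurable (\<F> t)" unfolding k_def h_def by measurable
  then show [measurable]: "q t \<in> borel_measurable (\<F> t)" unfolding q_def[abs_def] by measurable
  show "Q t \<in> borel_measurable (\<F> t)" "Rf t \<in> borel_measurable (\<F> t)" "S t \<in> borel_measurable (\<F> t)"
    unfolding Q_def[abs_def] Rf_def[abs_def] S_def[abs_def] by measurable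
qed

lemmas asset_measurable_M [measurable] = asset_measurable[THEN measurable_\<F>_M]

lemma AE_pos:
  "AE \<omega> in M. 0 < ec t \<omega>" "AE \<omega> in M. 0 < ed t \<omega>" "AE \<omega> in M. 0 < Cbar t \<omega>" "AE \<omega> in M. 0 < Div t \<omega>"
  using ec_pos ed_pos level_pos by (auto intro: AE_I2)

lemma Q_pos: "AE \<omega> in M. 0 < Q t \<omega>"
  using AE_pos(3)[of t] by eventually_elim (simp add: Q_def A_bounds)

lemma integrable_ec_transfer:
  fixes f :: "real \<Rightarrow> real"
  assumes [measurable]: "f \<in> borel_measurable borel" and f: "integrable M (\<lambda>\<omega>. f (ec 0 \<omega>))"
    and [measurable]: "X \<in> borel_measurable M" and X: "distr M borel X = distr M borel (ec 0)"
  shows "integrable M (\<lambda>\<omega>. f (X \<omega>))" "(\<integral>\<omega>. f (X \<omega>) \<partial>M) = (\<integral>\<omega>. f (ec 0 \<omega>) \<partial>M)"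
  using integrable_distr_eq[of X M borel f] integrable_distr_eq[of "ec 0" M borel f] f
    integral_distr[of X M borel f] integral_distr[of "ec 0" M borel f] by (auto simp: X)

text \<open>By homogeneity this utility is a known factor times the utility of
  \<open>etil s\<close>, which is integrable because \<open>etil s\<close> has the law of growth,
  plus a known term.\<close>

lemma cond_integrable_crra_reference:
  "cond_integrable M (\<F> s) (\<lambda>\<omega>. crra \<theta> (reference s \<omega>))"
proof -
  interpret sigma_finite_subalgebra M "\<F> s" by (rule sigma_finite_info)
  have [measurable]: "prev_level c0 ec s \<in> borel_measurable (\<F> s)"
    by (rule measurable_from_subalg[OF subalgebra_info_mono prev_level_measurable_info]) auto
  have "cond_integrable M (\<F> s) (\<lambda>\<omega>. crra \<theta> (etil s \<omega>))"
    by (intro cond_integrable_integrable integrable_ec_transfer(1)[OF crra_measurable crra_integrable _ etil_ident])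
       measurable
  then have *: "cond_integrable M (\<F> s) (\<lambda>\<omega>. prev_level c0 ec s \<omega> powr (1 - \<theta>) * crra \<theta> (etil s \<omega>)
      + (if \<theta> = 1 then ln (prev_level c0 ec s \<omega>) else 0))"
    by (rule cond_integrable_add(1)[OF cond_integrable_mult(1) cond_integrable_F_meas]; measurable)
  \<comment> \<open>Homogeneity requires positive arguments and \<open>etil s\<close> is positive
    only almost surely here, hence the passage through an almost sure bound.\<close>
  have "AE \<omega> in M. prev_level c0 ec s \<omega> > 0" using level_pos by (auto intro: AE_I2)
  with etil_pos[of s] have "AE \<omega> in M. \<bar>crra \<theta> (reference s \<omega>)\<bar>
      \<le> \<bar>prev_level c0 ec s \<omega> powr (1 - \<theta>) * crra \<theta> (etil s \<omega>) + (if \<theta> = 1 then ln (prev_level c0 ec s \<omega>) else 0)\<bar>"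
    by eventually_elim (simp add: reference_def crra_mult)
  then show ?thesis by (intro cond_integrable_bound[OF *]) measurable
qed

text \<open>The absolute value is at most \<open>lam\<close> times the sum of the two absolute
  utilities; that of consumption is known at \<open>s\<close>, that of the reference point is
  conditionally integrable.\<close>

lemma cond_integrable_gain_loss:
  assumes [measurable]: "C \<in> borel_measurable (\<F> s)"
  shows "cond_integrable M (\<F> s) (\<lambda>\<omega>. gain_loss lam (crra \<theta> (C \<omega>) - crra \<theta> (reference s \<omega>)))"
proof -
  interpret sigma_finite_subalgebra M "\<F> s" by (rule sigma_finite_info)
  have [measurable]: "C \<in> borel_measurable M" by (rule measurable_\<F>_M[OF assms])
  have R: "cond_integrable M (\<F> s) (\<lambda>\<omega>. \<bar>crra \<theta> (reference s \<omega>)\<bar>)"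
    by (rule cond_integrable_bound[OF cond_integrable_crra_reference]) auto
  have *: "cond_integrable M (\<F> s) (\<lambda>\<omega>. lam * (\<bar>crra \<theta> (C \<omega>)\<bar> + \<bar>crra \<theta> (reference s \<omega>)\<bar>))"
    by (rule cond_integrable_mult(1)[OF cond_integrable_add(1)[OF cond_integrable_F_meas R]]; measurable)
  show ?thesis
  proof (rule cond_integrable_bound[OF *], measurable, intro AE_I2)
    fix \<omega>
    have "\<bar>gain_loss lam (crra \<theta> (C \<omega>) - crra \<theta> (reference s \<omega>))\<bar> \<le> lam * \<bar>crra \<theta> (C \<omega>) - crra \<theta> (reference s \<omega>)\<bar>"
      by (rule abs_gain_loss_le[OF lam_ge])
    also have "\<dots> \<le> lam * (\<bar>crra \<theta> (C \<omega>)\<bar> + \<bar>crra \<theta> (reference s \<omega>)\<bar>)"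
      using lam_ge by (intro mult_left_mono) auto
    finally show "\<bar>gain_loss lam (crra \<theta> (C \<omega>) - crra \<theta> (reference s \<omega>))\<bar>
       \<le> \<bar>lam * (\<bar>crra \<theta> (C \<omega>)\<bar> + \<bar>crra \<theta> (reference s \<omega>)\<bar>)\<bar>" by simp
  qed
qed

text \<open>
  At a tie \<open>etil s = ec s\<close> every slope in \<open>[1, lam]\<close> is a supergradient of \<open>gain_loss lam\<close>; the choice \<open>1\<close>
  makes the conditional expectation of \<open>slope\<close> a function of the distribution function itself.
\<close>

definition slope :: "nat \<Rightarrow> 'a \<Rightarrow> real" where
  "slope s \<omega> = (if etil s \<omega> \<le> ec s \<omega> then 1 else lam)"

lemma real_cond_exp_slope:
  "cond_integrable M (\<F> s) (slope s)"
  "AE \<omega> in M. real_cond_exp M (\<F> s) (slope s) \<omega> = Feps (ec s \<omega>) + lam * (1 - Feps (ec s \<omega>))"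
proof -
  interpret sigma_finite_subalgebra M "\<F> s" by (rule sigma_finite_info)
  interpret d: prob_space "distr M borel (etil s)" by (rule prob_space_distr) simp
  have [measurable]: "slope s \<in> borel_measurable M" unfolding slope_def[abs_def] by measurable
  have bd: "0 \<le> slope s \<omega>" "\<bar>slope s \<omega>\<bar> \<le> lam" for \<omega> using lam_ge by (auto simp: slope_def)
  show "cond_integrable M (\<F> s) (slope s)"
    using bd by (intro cond_integrable_integrable integrable_const_bound[of _ lam]) auto
  have "AE \<omega> in M. real_cond_exp M (\<F> s) (slope s) \<omega> = enn2real (nn_cond_exp M (\<F> s) (\<lambda>\<omega>. ennreal (slope s \<omega>)) \<omega>)"
    using bd by (intro real_cond_exp_nonneg) auto
  moreover have "AE \<omega> in M. nn_cond_exp M (\<F> s) (\<lambda>\<omega>. ennreal (slope s \<omega>)) \<omega>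
      = (\<integral>\<^sup>+ y. ennreal (if y \<le> ec s \<omega> then 1 else lam) \<partial>distr M borel (etil s))"
    unfolding slope_def
    by (rule nn_cond_exp_freeze[OF subalgebra_info etil_meas etil_indep_info]) measurable
  moreover have "(\<integral>\<^sup>+ y. ennreal (if y \<le> x then 1 else lam) \<partial>distr M borel (etil s))
      = ennreal (Feps x + lam * (1 - Feps x))" for x
  proof -
    have "(\<integral>\<^sup>+ y. ennreal (if y \<le> x then 1 else lam) \<partial>distr M borel (etil s))
       = (\<integral>\<^sup>+ y. indicator {..x} y + ennreal lam * indicator (UNIV - {..x}) y \<partial>distr M borel (etil s))"
      by (rule nn_integral_cong) (auto simp: indicator_def)
    also have "\<dots> = emeasure (distr M borel (etil s)) {..x} + ennreal lam * emeasure (distr M borel (etil s)) (UNIV - {..x})"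
      by (subst nn_integral_add) (auto simp: nn_integral_cmult)
    also have "\<dots> = ennreal (Feps x) + ennreal lam * ennreal (1 - Feps x)"
      using d.prob_compl[of "{..x}"]
      by (simp add: d.emeasure_eq_measure Feps_def cdf_def etil_ident[of s, symmetric])
    also have "\<dots> = ennreal (Feps x + lam * (1 - Feps x))"
      using Feps_range lam_ge by (simp flip: ennreal_mult ennreal_plus)
    finally show ?thesis .
  qed
  moreover have "0 \<le> Feps x + lam * (1 - Feps x)" for x using Feps_range lam_ge by simp
  ultimately show "AE \<omega> in M. real_cond_exp M (\<F> s) (slope s) \<omega> = Feps (ec s \<omega>) + lam * (1 - Feps (ec s \<omega>))"
    by (auto elim!: eventually_elim2)
qed

text \<open>Two supergradients are composed. \<open>slope\<close> bounds gain-loss utility in terms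
  of the utility increment \<open>?d\<close>, which is known at \<open>s\<close> and leaves the
  conditional expectation. Direct utility has weight \<open>1\<close> and gain-loss utility
  \<open>b\<close> times the mean slope, together \<open>A (ec s)\<close>. The tangent of
  \<open>crra\<close> then bounds \<open>?d\<close> in terms of consumption.\<close>

lemma utility_le_tangent:
  assumes C[measurable]: "C s \<in> borel_measurable (\<F> s)" and pos: "AE \<omega> in M. 0 < C s \<omega>"
  shows "AE \<omega> in M. utility C s \<omega> \<le> utility Cbar s \<omega> + Q s \<omega> * (C s \<omega> - Cbar s \<omega>)"
proof -
  interpret sigma_finite_subalgebra M "\<F> s" by (rule sigma_finite_info)
  let ?E = "real_cond_exp M (\<F> s)"
  let ?d = "\<lambda>\<omega>. crra \<theta> (C s \<omega>) - crra \<theta> (Cbar s \<omega>)"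
  let ?g = "\<lambda>C \<omega>. gain_loss lam (crra \<theta> (C s \<omega>) - crra \<theta> (reference s \<omega>))"
  have d[measurable]: "?d \<in> borel_measurable (\<F> s)" by measurable
  have gC: "cond_integrable M (\<F> s) (?g C)" and gB: "cond_integrable M (\<F> s) (?g Cbar)"
    by (rule cond_integrable_gain_loss; measurable)+
  note ds = cond_integrable_mult[OF real_cond_exp_slope(1)[of s] d]
  have prev_pos: "AE \<omega> in M. prev_level c0 ec s \<omega> > 0" using level_pos by (auto intro: AE_I2)
  have "AE \<omega> in M. ?g C \<omega> \<le> ?g Cbar \<omega> + ?d \<omega> * slope s \<omega>"
    using etil_pos[of s] AE_pos(1)[of s] AE_pos(3)[of s] prev_pos
  proof eventually_elim
    case (elim \<omega>)
    \<comment> \<open>Both levels contain the factor \<open>prev_level\<close>, so comparing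
      consumption with its reference point amounts to comparing \<open>ec s\<close> with
      \<open>etil s\<close>.\<close>
    have "crra \<theta> (reference s \<omega>) \<le> crra \<theta> (Cbar s \<omega>)" if "etil s \<omega> \<le> ec s \<omega>"
      using elim that by (intro crra_mono \<theta>_pos) (auto simp: reference_def level_eq_prev_level)
    moreover have "crra \<theta> (Cbar s \<omega>) \<le> crra \<theta> (reference s \<omega>)" if "\<not> etil s \<omega> \<le> ec s \<omega>"
      using elim that by (intro crra_mono \<theta>_pos) (auto simp: reference_def level_eq_prev_level)
    ultimately have "gain_loss lam (crra \<theta> (C s \<omega>) - crra \<theta> (reference s \<omega>))
       \<le> ?g Cbar \<omega> + ((crra \<theta> (C s \<omega>) - crra \<theta> (reference s \<omega>)) - (crra \<theta> (Cbar s \<omega>) - crra \<theta> (reference s \<omega>))) * slope s \<omega>"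
      by (intro gain_loss_le_tangent lam_ge) (auto simp: slope_def)
    then show ?case by simp
  qed
  from cond_integrable_mono[OF gC cond_integrable_add(1)[OF gB ds(1)] this]
  show ?thesis
    using cond_integrable_add(2)[OF gB ds(1)] ds(2) real_cond_exp_slope(2)[of s] AE_pos(3)[of s] pos
  proof eventually_elim
    case (elim \<omega>)
    let ?w = "Feps (ec s \<omega>) + lam * (1 - Feps (ec s \<omega>))"
    have "?E (?g C) \<omega> \<le> ?E (?g Cbar) \<omega> + ?d \<omega> * ?w" using elim(1-4) by simp
    from mult_left_mono[OF this b_nonneg]
    have "utility C s \<omega> \<le> utility Cbar s \<omega> + ?d \<omega> * A (ec s \<omega>)"
      by (simp add: period_utility_def A_def algebra_simps)
    \<comment> \<open>Although \<open>?d\<close> has no fixed sign, its upper bound may be inserted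
      because the weight \<open>A\<close> is positive.\<close>
    also have "?d \<omega> * A (ec s \<omega>) \<le> (Cbar s \<omega> powr (- \<theta>) * (C s \<omega> - Cbar s \<omega>)) * A (ec s \<omega>)"
      using crra_le_tangent[OF \<theta>_pos elim(5,6)] A_bounds(3)[of "ec s \<omega>"] by (intro mult_right_mono) auto
    finally show ?case by (simp add: Q_def mult_ac)
  qed
qed

section \<open>Moments of growth weighted by \<open>A\<close>\<close>

lemma integral_ec_A: "(\<integral>\<omega>. ec t \<omega> powr (- \<theta>) * A (ec t \<omega>) \<partial>M) = K"
  and integrable_ec_A: "integrable M (\<lambda>\<omega>. ec t \<omega> powr (- \<theta>) * A (ec t \<omega>))"
proof -
  have "integrable M (\<lambda>\<omega>. ec 0 \<omega> powr (- \<theta>) * A (ec 0 \<omega>))"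
    using powr_integrable
  proof (rule Bochner_Integration.integrable_bound[OF integrable_mult_right[of "1 + b * lam"]])
    show "AE \<omega> in M. norm (ec 0 \<omega> powr (- \<theta>) * A (ec 0 \<omega>)) \<le> norm ((1 + b * lam) * ec 0 \<omega> powr (- \<theta>))"
    proof (rule AE_I2)
      fix \<omega>
      show "norm (ec 0 \<omega> powr (- \<theta>) * A (ec 0 \<omega>)) \<le> norm ((1 + b * lam) * ec 0 \<omega> powr (- \<theta>))"
        using mult_left_mono[OF A_bounds(2), of "ec 0 \<omega> powr (- \<theta>)" "ec 0 \<omega>"] A_bounds(3)[of "ec 0 \<omega>"] b_nonneg lam_ge
        by (simp add: abs_mult mult.commute)
    qed
  qed measurable
  then show "(\<integral>\<omega>. ec t \<omega> powr (- \<theta>) * A (ec t \<omega>) \<partial>M) = K"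
    "integrable M (\<lambda>\<omega>. ec t \<omega> powr (- \<theta>) * A (ec t \<omega>))"
    unfolding K_def
    using integrable_ec_transfer[of "\<lambda>x. x powr (- \<theta>) * A x" "ec t"] ec_ident[of t] by auto
qed

lemma K_pos: "K > 0"
proof -
  have "AE \<omega> in M. 0 < ec 0 \<omega> powr (- \<theta>) * A (ec 0 \<omega>)"
    using AE_pos(1)[of 0] by eventually_elim (simp add: A_bounds)
  then show ?thesis
    unfolding K_def using integrable_ec_A[of 0]
    using integral_less_AE_space[of "\<lambda>_. 0" "\<lambda>\<omega>. ec 0 \<omega> powr (- \<theta>) * A (ec 0 \<omega>)"]
    by (simp add: emeasure_space_1)
qed

text \<open>After freezing, the integrand no longer depends on the state, so a constant remains,
  namely the unconditional mean.\<close>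

lemma real_cond_exp_future:
  assumes [measurable]: "f \<in> borel_measurable borel" and f: "integrable M (\<lambda>\<omega>. f (ec (Suc t) \<omega>))"
    and pos: "\<And>x. 0 \<le> f x"
  shows "AE \<omega> in M. real_cond_exp M (\<F> t) (\<lambda>\<omega>. f (ec (Suc t) \<omega>)) \<omega> = (\<integral>\<omega>. f (ec (Suc t) \<omega>) \<partial>M)"
proof -
  interpret sigma_finite_subalgebra M "\<F> t" by (rule sigma_finite_info)
  have "AE \<omega> in M. nn_cond_exp M (\<F> t) (\<lambda>\<omega>. ennreal (f (ec (Suc t) \<omega>))) \<omega>
      = (\<integral>\<^sup>+ y. ennreal (f y) \<partial>distr M borel (ec (Suc t)))"
    by (rule nn_cond_exp_freeze[OF subalgebra_info ec_meas ec_indep_past]) measurable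
  moreover have "(\<integral>\<^sup>+ y. ennreal (f y) \<partial>distr M borel (ec (Suc t))) = ennreal (\<integral>\<omega>. f (ec (Suc t) \<omega>) \<partial>M)"
    using pos f by (simp add: nn_integral_distr nn_integral_eq_integral)
  moreover have "AE \<omega> in M. real_cond_exp M (\<F> t) (\<lambda>\<omega>. f (ec (Suc t) \<omega>)) \<omega>
      = enn2real (nn_cond_exp M (\<F> t) (\<lambda>\<omega>. ennreal (f (ec (Suc t) \<omega>))) \<omega>)"
    using pos by (intro real_cond_exp_nonneg) auto
  moreover have "0 \<le> (\<integral>\<omega>. f (ec (Suc t) \<omega>) \<partial>M)" using pos by simp
  ultimately show ?thesis by (auto elim!: eventually_elim2)
qed

lemma real_cond_exp_ec_A:
  "AE \<omega> in M. real_cond_exp M (\<F> t) (\<lambda>\<omega>. ec (Suc t) \<omega> powr (- \<theta>) * A (ec (Suc t) \<omega>)) \<omega> = K"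
  using real_cond_exp_future[of "\<lambda>x. x powr (- \<theta>) * A x" t] integrable_ec_A integral_ec_A A_bounds(3)
  by (simp add: less_imp_le)

lemma h_cond_integrable:
  "cond_integrable M (\<F> t) (\<lambda>\<omega>. ec (Suc t) \<omega> powr (- \<theta>) * ed (Suc t) \<omega> * A (ec (Suc t) \<omega>))"
proof -
  interpret sigma_finite_subalgebra M "\<F> t" by (rule sigma_finite_info)
  have *: "cond_integrable M (\<F> t) (\<lambda>\<omega>. (1 + b * lam) * (ec (Suc t) \<omega> powr (- \<theta>) * ed (Suc t) \<omega>))"
    by (rule cond_integrable_mult(1)[OF growth_cond_integrable]) simp
  have "\<bar>x * A y\<bar> \<le> \<bar>(1 + b * lam) * x\<bar>" for x y
    using A_bounds[of y] mult_right_mono[of "A y" "1 + b * lam" "\<bar>x\<bar>"] by (simp add: abs_mult mult.commute)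
  then show ?thesis by (intro cond_integrable_bound[OF *]) auto
qed

lemma k_pos: "AE \<omega> in M. 0 < k t \<omega>"
proof -
  interpret sigma_finite_subalgebra M "\<F> t" by (rule sigma_finite_info)
  have pos: "AE \<omega> in M. 0 < ec (Suc t) \<omega> powr (- \<theta>) * ed (Suc t) \<omega>"
    using AE_pos(1,2)[of "Suc t"] by eventually_elim simp
  then have "AE \<omega> in M. 0 < nn_cond_exp M (\<F> t) (\<lambda>\<omega>. ennreal (ec (Suc t) \<omega> powr (- \<theta>) * ed (Suc t) \<omega>)) \<omega>"
    by (intro nn_cond_exp_pos) auto
  moreover have "AE \<omega> in M. 0 \<le> ec (Suc t) \<omega> powr (- \<theta>) * ed (Suc t) \<omega>" using pos by eventually_elim simp
  from nn_cond_exp_eq_real_cond_exp[OF growth_cond_integrable this]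
  have "AE \<omega> in M. nn_cond_exp M (\<F> t) (\<lambda>\<omega>. ennreal (ec (Suc t) \<omega> powr (- \<theta>) * ed (Suc t) \<omega>)) \<omega> = ennreal (k t \<omega>)"
    by (simp add: k_def)
  ultimately show ?thesis by eventually_elim (simp add: ennreal_less_zero_iff)
qed

lemma h_ge: "AE \<omega> in M. (1 + b) * k t \<omega> \<le> h t \<omega>"
proof -
  interpret sigma_finite_subalgebra M "\<F> t" by (rule sigma_finite_info)
  have "AE \<omega> in M. (1 + b) * (ec (Suc t) \<omega> powr (- \<theta>) * ed (Suc t) \<omega>) \<le> ec (Suc t) \<omega> powr (- \<theta>) * ed (Suc t) \<omega> * A (ec (Suc t) \<omega>)"
    using AE_pos(2)[of "Suc t"]
  proof eventually_elim
    case (elim \<omega>)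
    show ?case
      using mult_left_mono[OF A_bounds(1)[of "ec (Suc t) \<omega>"], of "ec (Suc t) \<omega> powr (- \<theta>) * ed (Suc t) \<omega>"] elim
      by (simp add: mult_ac)
  qed
  from cond_integrable_mono[OF cond_integrable_mult(1)[OF growth_cond_integrable] h_cond_integrable this]
    cond_integrable_mult(2)[OF growth_cond_integrable, of "\<lambda>_. 1 + b"]
  show ?thesis unfolding h_def k_def by auto
qed

end

section \<open>Prices and the budget identity\<close>

text \<open>This is \<open>u - v \<le> x - y\<close> in a form free of subtraction: \<open>u\<close>
  and \<open>v\<close> are replaced by their parts and each negative term is moved across. In this
  form it survives conditioning and infinite sums.\<close>

lemma ennreal_utility_transfer:
  fixes u v x y :: real
  assumes "u \<le> v + (x - y)" "0 \<le> x" "0 \<le> y"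
  shows "ennreal u + ennreal (- v) + ennreal y \<le> ennreal v + ennreal (- u) + ennreal x"
proof -
  have p: "ennreal z = ennreal (max z 0)" for z by (simp add: max_def ennreal_neg)
  \<comment> \<open>The occurrences rewritten are those whose argument may be negative; the two
    others are \<open>y\<close> and \<open>x\<close>.\<close>
  show ?thesis
    using assms by (subst (1 2 4 5) p) (auto simp flip: ennreal_plus intro!: ennreal_leI simp: max_def)
qed

text \<open>Adding \<open>x\<close> to the inequality makes the second assumption applicable, after
  which \<open>w\<close> cancels. Here \<open>w\<close> will be the conditional value of next-period
  wealth, which is finite; the utility terms may be infinite.\<close>

lemma ennreal_budget_cancel:
  fixes \<phi> c \<gamma> w \<tau> x z :: ennreal
  assumes "\<phi> + c \<le> \<gamma> + w + \<tau>" "w + z = x + c" "w < \<infinity>"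
  shows "\<phi> + z \<le> \<gamma> + x + \<tau>"
proof -
  have "w + (\<phi> + z) = (\<phi> + c) + x" using assms(2) by (simp add: ac_simps)
  also have "\<dots> \<le> (\<gamma> + w + \<tau>) + x" by (intro add_mono assms(1)) simp
  also have "\<dots> = w + (\<gamma> + x + \<tau>)" by (simp add: ac_simps)
  finally show ?thesis using assms(3) by (auto simp: ennreal_add_left_cancel_le)
qed

text \<open>Neither difference is infinity minus infinity. If \<open>p'\<close> is infinite the
  right side is infinity, if \<open>n\<close> is infinite the left side is minus infinity, and
  otherwise the assumed inequality makes all four terms finite.\<close>

lemma ereal_diff_le_diff:
  fixes p n p' n' :: ennreal
  assumes "p + n' \<le> p' + n" "p < \<infinity> \<or> n < \<infinity>" "p' < \<infinity> \<or> n' < \<infinity>"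
  shows "enn2ereal p - enn2ereal n \<le> enn2ereal p' - enn2ereal n'"
proof (cases "p' = \<infinity> \<or> n = \<infinity>")
  case True
  then show ?thesis
  proof
    assume "p' = \<infinity>"
    then have "enn2ereal p' - enn2ereal n' = \<infinity>" using assms(3)
      by (cases n') auto
    then show ?thesis by simp
  next
    assume "n = \<infinity>"
    then have "enn2ereal p - enn2ereal n = - \<infinity>" using assms(2)
      by (cases p) auto
    then show ?thesis by simp
  qed
next
  case False
  then obtain rp' rn where r: "p' = ennreal rp'" "0 \<le> rp'" "n = ennreal rn" "0 \<le> rn"
    by (metis ennreal_cases infinity_ennreal_def)
  then have "p + n' < \<infinity>" using assms(1) by (metis ennreal_plus ennreal_less_top infinity_ennreal_def le_less_trans)
  then obtain rp rn' where s: "p = ennreal rp" "0 \<le> rp" "n' = ennreal rn'" "0 \<le> rn'"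
    by (cases p; cases n') auto
  show ?thesis using assms(1) r s by (simp flip: ennreal_plus add: enn2ereal_ennreal)
qed

locale gain_loss_equilibrium = gain_loss_economy +
  assumes growth: "\<And>t. AE \<omega> in M. \<beta> * k t \<omega> < 1"
    and q_const: "\<And>t. AE \<omega> in M. q (Suc t) \<omega> = q t \<omega>"
begin

section \<open>Euler equations for stock and bond\<close>

lemma h_pos: "AE \<omega> in M. 0 < h t \<omega>"
  using h_ge[of t] k_pos[of t]
proof eventually_elim
  case (elim \<omega>)
  have "0 < (1 + b) * k t \<omega>" using elim b_nonneg by (simp add: add_pos_nonneg)
  then show ?case using elim by linarith
qed

lemma q_pos: "AE \<omega> in M. 0 < q t \<omega>"
  using h_pos[of t] growth[of t] by eventually_elim (use \<beta>_pos in \<open>simp add: q_def\<close>)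

lemma S_pos: "AE \<omega> in M. 0 < S t \<omega>"
  using q_pos[of t] AE_pos(4)[of t] by eventually_elim (simp add: S_def A_bounds)

text \<open>The \<open>A (ec t)\<close> in marginal utility cancels the one in the price. The value
  of the stock in utility units thus moves only with consumption, dividends and
  \<open>q\<close>.\<close>

lemma QS_eq: "Q t \<omega> * S t \<omega> = Cbar t \<omega> powr (- \<theta>) * Div t \<omega> * q t \<omega>"
  using A_bounds(3)[of "ec t \<omega>"] by (simp add: Q_def S_def)

lemma Cbar_powr_Suc: "AE \<omega> in M. Cbar (Suc t) \<omega> powr a = Cbar t \<omega> powr a * ec (Suc t) \<omega> powr a"
  using AE_pos(1)[of "Suc t"] AE_pos(3)[of t] by eventually_elim (simp add: level_Suc powr_mult)

text \<open>Since \<open>q\<close> is constant, one period multiplies \<open>Q t * S t\<close> by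
  the growth term whose conditional mean is \<open>k t\<close>. The resale price thus carries the
  share \<open>\<beta> * k t\<close> of today's value.\<close>

lemma price_S:
  "AE \<omega> in M. nn_cond_exp M (\<F> t) (\<lambda>\<omega>. ennreal (\<beta> * Q (Suc t) \<omega> * S (Suc t) \<omega>)) \<omega>
     = ennreal (\<beta> * k t \<omega> * (Q t \<omega> * S t \<omega>))"
proof -
  interpret sigma_finite_subalgebra M "\<F> t" by (rule sigma_finite_info)
  let ?a = "\<lambda>\<omega>. \<beta> * (Q t \<omega> * S t \<omega>)" and ?X = "\<lambda>\<omega>. ec (Suc t) \<omega> powr (- \<theta>) * ed (Suc t) \<omega>"
  have "AE \<omega> in M. \<beta> * Q (Suc t) \<omega> * S (Suc t) \<omega> = ?a \<omega> * ?X \<omega>"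
    using Cbar_powr_Suc[of t "- \<theta>"] q_const[of t]
  proof eventually_elim
    case (elim \<omega>)
    show ?case unfolding mult.assoc QS_eq by (simp add: elim level_Suc[of d0] mult_ac)
  qed
  moreover have "AE \<omega> in M. 0 \<le> ?X \<omega>" using AE_pos(2)[of "Suc t"] by eventually_elim simp
  moreover have "AE \<omega> in M. 0 \<le> ?a \<omega>"
    using Q_pos[of t] S_pos[of t] by eventually_elim (use \<beta>_pos in simp)
  ultimately have "AE \<omega> in M. nn_cond_exp M (\<F> t) (\<lambda>\<omega>. ennreal (\<beta> * Q (Suc t) \<omega> * S (Suc t) \<omega>)) \<omega>
      = ennreal (?a \<omega> * k t \<omega>)"
    unfolding k_def by (intro nn_cond_exp_mult_real growth_cond_integrable) measurable
  then show ?thesis by eventually_elim (simp add: mult_ac)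
qed

text \<open>Dividends are not divided by \<open>A\<close>, so the \<open>A\<close> of next-period
  marginal utility survives and produces \<open>h t\<close>. The definition of \<open>q\<close> then
  says that dividends carry the remaining share \<open>1 - \<beta> * k t\<close>.\<close>

lemma price_Div:
  "AE \<omega> in M. nn_cond_exp M (\<F> t) (\<lambda>\<omega>. ennreal (\<beta> * Q (Suc t) \<omega> * Div (Suc t) \<omega>)) \<omega>
     = ennreal ((1 - \<beta> * k t \<omega>) * (Q t \<omega> * S t \<omega>))"
proof -
  interpret sigma_finite_subalgebra M "\<F> t" by (rule sigma_finite_info)
  let ?a = "\<lambda>\<omega>. \<beta> * (Cbar t \<omega> powr (- \<theta>) * Div t \<omega>)"
  let ?X = "\<lambda>\<omega>. ec (Suc t) \<omega> powr (- \<theta>) * ed (Suc t) \<omega> * A (ec (Suc t) \<omega>)"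
  have "AE \<omega> in M. \<beta> * Q (Suc t) \<omega> * Div (Suc t) \<omega> = ?a \<omega> * ?X \<omega>"
    using Cbar_powr_Suc[of t "- \<theta>"] by eventually_elim (simp add: Q_def level_Suc[of d0] mult_ac)
  moreover have "AE \<omega> in M. 0 \<le> ?X \<omega>"
    using AE_pos(2)[of "Suc t"] by eventually_elim (simp add: A_bounds less_imp_le)
  moreover have "AE \<omega> in M. 0 \<le> ?a \<omega>"
    using AE_pos(4)[of t] by eventually_elim (use \<beta>_pos in simp)
  ultimately have "AE \<omega> in M. nn_cond_exp M (\<F> t) (\<lambda>\<omega>. ennreal (\<beta> * Q (Suc t) \<omega> * Div (Suc t) \<omega>)) \<omega>
      = ennreal (?a \<omega> * h t \<omega>)"
    unfolding h_def by (intro nn_cond_exp_mult_real h_cond_integrable) measurable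
  then show ?thesis using growth[of t]
  proof eventually_elim
    case (elim \<omega>)
    have "\<beta> * h t \<omega> = (1 - \<beta> * k t \<omega>) * q t \<omega>" using elim(2) by (simp add: q_def)
    then have "?a \<omega> * h t \<omega> = (1 - \<beta> * k t \<omega>) * (Q t \<omega> * S t \<omega>)"
      unfolding QS_eq by (simp add: mult_ac)
    then show ?case using elim(1) by simp
  qed
qed

lemma price_S_Div:
  "AE \<omega> in M. nn_cond_exp M (\<F> t) (\<lambda>\<omega>. ennreal (\<beta> * Q (Suc t) \<omega> * S (Suc t) \<omega>)) \<omega>
     + nn_cond_exp M (\<F> t) (\<lambda>\<omega>. ennreal (\<beta> * Q (Suc t) \<omega> * Div (Suc t) \<omega>)) \<omega> = ennreal (Q t \<omega> * S t \<omega>)"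
  using price_S[of t] price_Div[of t] growth[of t] k_pos[of t] Q_pos[of t] S_pos[of t]
proof eventually_elim
  case (elim \<omega>)
  then have "0 \<le> \<beta> * k t \<omega> * (Q t \<omega> * S t \<omega>)" "0 \<le> (1 - \<beta> * k t \<omega>) * (Q t \<omega> * S t \<omega>)"
    using \<beta>_pos by auto
  then show ?case using elim(1,2) by (simp flip: ennreal_plus) (simp add: algebra_simps)
qed

lemma stock_return_pos: "AE \<omega> in M. 0 < stock_return S Div t \<omega>"
  using S_pos[of t] S_pos[of "Suc t"] AE_pos(4)[of "Suc t"] by eventually_elim (simp add: stock_return_def)

lemma stock_return_measurable [measurable]:
  "stock_return S Div t \<in> borel_measurable (\<F> (Suc t))" "stock_return S Div t \<in> borel_measurable M"
proof -
  have [measurable]: "S t \<in> borel_measurable (\<F> (Suc t))"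
    by (rule measurable_from_subalg[OF subalgebra_info_mono asset_measurable(6)]) auto
  show "stock_return S Div t \<in> borel_measurable (\<F> (Suc t))" unfolding stock_return_def[abs_def] by measurable
  then show "stock_return S Div t \<in> borel_measurable M" by (rule measurable_\<F>_M)
qed

text \<open>The Euler equation is put in return form because the budget constraint multiplies
  returns by holdings; \<open>S t\<close> is known today and divides out.\<close>

lemma price_stock:
  "AE \<omega> in M. nn_cond_exp M (\<F> t) (\<lambda>\<omega>. ennreal (\<beta> * Q (Suc t) \<omega> * stock_return S Div t \<omega>)) \<omega> = ennreal (Q t \<omega>)"
proof -
  interpret sigma_finite_subalgebra M "\<F> t" by (rule sigma_finite_info)
  let ?s = "\<lambda>\<omega>. ennreal (\<beta> * Q (Suc t) \<omega> * S (Suc t) \<omega>)" and ?d = "\<lambda>\<omega>. ennreal (\<beta> * Q (Suc t) \<omega> * Div (Suc t) \<omega>)"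
  have "AE \<omega> in M. ennreal (\<beta> * Q (Suc t) \<omega> * stock_return S Div t \<omega>) = ennreal (1 / S t \<omega>) * (?s \<omega> + ?d \<omega>)"
    using S_pos[of t] S_pos[of "Suc t"] AE_pos(4)[of "Suc t"] Q_pos[of "Suc t"]
  proof eventually_elim
    case (elim \<omega>)
    then have "0 \<le> \<beta> * Q (Suc t) \<omega> * S (Suc t) \<omega>" "0 \<le> \<beta> * Q (Suc t) \<omega> * Div (Suc t) \<omega>" "0 \<le> 1 / S t \<omega>"
      using \<beta>_pos by auto
    then show ?case
      by (simp flip: ennreal_plus ennreal_mult) (simp add: stock_return_def divide_inverse algebra_simps)
  qed
  then have 1: "AE \<omega> in M. nn_cond_exp M (\<F> t) (\<lambda>\<omega>. ennreal (\<beta> * Q (Suc t) \<omega> * stock_return S Div t \<omega>)) \<omega>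
     = nn_cond_exp M (\<F> t) (\<lambda>\<omega>. ennreal (1 / S t \<omega>) * (?s \<omega> + ?d \<omega>)) \<omega>"
    by (rule nn_cond_exp_cong[OF eventually_mono]; (simp only: | measurable))
  have 2: "AE \<omega> in M. ennreal (1 / S t \<omega>) * nn_cond_exp M (\<F> t) (\<lambda>\<omega>. ?s \<omega> + ?d \<omega>) \<omega>
     = nn_cond_exp M (\<F> t) (\<lambda>\<omega>. ennreal (1 / S t \<omega>) * (?s \<omega> + ?d \<omega>)) \<omega>"
    by (intro nn_cond_exp_prod) measurable
  have 3: "AE \<omega> in M. nn_cond_exp M (\<F> t) ?s \<omega> + nn_cond_exp M (\<F> t) ?d \<omega> = nn_cond_exp M (\<F> t) (\<lambda>\<omega>. ?s \<omega> + ?d \<omega>) \<omega>"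
    by (intro nn_cond_exp_sum) measurable
  show ?thesis
    using 1 2 3 price_S_Div[of t] S_pos[of t] Q_pos[of t]
  proof eventually_elim
    case (elim \<omega>)
    have "ennreal (1 / S t \<omega>) * ennreal (Q t \<omega> * S t \<omega>) = ennreal (Q t \<omega>)"
      using elim(5,6) by (simp flip: ennreal_mult)
    then show ?case using elim(1-4) by simp
  qed
qed

lemma Rf_pos: "0 < Rf t \<omega>"
  using A_bounds K_pos \<beta>_pos by (simp add: Rf_def)

text \<open>All factors except next-period growth are known today, and the conditional mean of the
  growth term is \<open>K\<close>, by which \<open>Rf t\<close> was divided.\<close>

lemma price_bond:
  "AE \<omega> in M. nn_cond_exp M (\<F> t) (\<lambda>\<omega>. ennreal (\<beta> * Q (Suc t) \<omega> * Rf t \<omega>)) \<omega> = ennreal (Q t \<omega>)"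
proof -
  interpret sigma_finite_subalgebra M "\<F> t" by (rule sigma_finite_info)
  let ?a = "\<lambda>\<omega>. \<beta> * Cbar t \<omega> powr (- \<theta>) * Rf t \<omega>"
  let ?X = "\<lambda>\<omega>. ec (Suc t) \<omega> powr (- \<theta>) * A (ec (Suc t) \<omega>)"
  have "AE \<omega> in M. \<beta> * Q (Suc t) \<omega> * Rf t \<omega> = ?a \<omega> * ?X \<omega>"
    using Cbar_powr_Suc[of t "- \<theta>"] by eventually_elim (simp add: Q_def mult_ac)
  moreover have "AE \<omega> in M. 0 \<le> ?X \<omega>" by (simp add: A_bounds less_imp_le)
  moreover have "AE \<omega> in M. 0 \<le> ?a \<omega>" using Rf_pos \<beta>_pos by (simp add: less_imp_le)
  ultimately have "AE \<omega> in M. nn_cond_exp M (\<F> t) (\<lambda>\<omega>. ennreal (\<beta> * Q (Suc t) \<omega> * Rf t \<omega>)) \<omega>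
      = ennreal (?a \<omega> * real_cond_exp M (\<F> t) ?X \<omega>)"
    by (intro nn_cond_exp_mult_real cond_integrable_integrable integrable_ec_A) measurable
  then show ?thesis using real_cond_exp_ec_A[of t]
    by eventually_elim (use K_pos \<beta>_pos in \<open>simp add: Rf_def Q_def mult_ac\<close>)
qed

text \<open>Marginal utility times consumption is the bounded \<open>A\<close> times consumption to
  the power \<open>1 - \<theta>\<close>. The mean of that power of growth is finite because it is a
  multiple of \<open>crra\<close>, or trivially if \<open>\<theta> = 1\<close>. Finiteness permits
  splitting labor income into \<open>Cbar\<close> and \<open>Div\<close>.\<close>

lemma price_Cbar_finite:
  "AE \<omega> in M. nn_cond_exp M (\<F> t) (\<lambda>\<omega>. ennreal (\<beta> * Q (Suc t) \<omega> * Cbar (Suc t) \<omega>)) \<omega> < \<infinity>"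
proof -
  interpret sigma_finite_subalgebra M "\<F> t" by (rule sigma_finite_info)
  have "integrable M (\<lambda>\<omega>. ec 0 \<omega> powr (1 - \<theta>))"
  proof (cases "\<theta> = 1")
    case True
    have "AE \<omega> in M. ec 0 \<omega> powr (1 - \<theta>) = 1" using AE_pos(1)[of 0] by eventually_elim (simp add: True)
    then have "integrable M (\<lambda>\<omega>. ec 0 \<omega> powr (1 - \<theta>)) \<longleftrightarrow> integrable M (\<lambda>\<omega>. 1 :: real)"
      by (intro integrable_cong_AE) auto
    then show ?thesis by simp
  next
    case False
    have "integrable M (\<lambda>\<omega>. (1 - \<theta>) * crra \<theta> (ec 0 \<omega>))" by (intro integrable_mult_right crra_integrable)
    then show ?thesis using False by (simp add: crra_def)
  qed
  then have "integrable M (\<lambda>\<omega>. ec (Suc t) \<omega> powr (1 - \<theta>))"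
    by (rule integrable_ec_transfer(1)[of "\<lambda>x. x powr (1 - \<theta>)", OF _ _ _ ec_ident, rotated]) measurable
  then have *: "cond_integrable M (\<F> t) (\<lambda>\<omega>. (\<beta> * (1 + b * lam) * Cbar t \<omega> powr (1 - \<theta>)) * ec (Suc t) \<omega> powr (1 - \<theta>))"
    by (intro cond_integrable_mult(1) cond_integrable_integrable) measurable
  have "AE \<omega> in M. \<bar>\<beta> * Q (Suc t) \<omega> * Cbar (Suc t) \<omega>\<bar>
      \<le> \<bar>(\<beta> * (1 + b * lam) * Cbar t \<omega> powr (1 - \<theta>)) * ec (Suc t) \<omega> powr (1 - \<theta>)\<bar>"
    using Cbar_powr_Suc[of t "1 - \<theta>"] AE_pos(3)[of "Suc t"]
  proof eventually_elim
    case (elim \<omega>)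
    have "Cbar (Suc t) \<omega> powr (- \<theta>) * Cbar (Suc t) \<omega> = Cbar (Suc t) \<omega> powr (1 - \<theta>)"
      using elim(2) by (simp add: powr_diff powr_minus_divide)
    then have "\<beta> * Q (Suc t) \<omega> * Cbar (Suc t) \<omega> = \<beta> * A (ec (Suc t) \<omega>) * Cbar (Suc t) \<omega> powr (1 - \<theta>)"
      by (simp add: Q_def mult_ac)
    then have "\<bar>\<beta> * Q (Suc t) \<omega> * Cbar (Suc t) \<omega>\<bar> = \<bar>\<beta> * A (ec (Suc t) \<omega>) * Cbar (Suc t) \<omega> powr (1 - \<theta>)\<bar>"
      by (simp only:)
    also have "\<dots> = \<beta> * A (ec (Suc t) \<omega>) * Cbar (Suc t) \<omega> powr (1 - \<theta>)"
      using A_bounds(3)[of "ec (Suc t) \<omega>"] \<beta>_pos by (intro abs_of_nonneg) simp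
    also have "\<dots> \<le> \<beta> * (1 + b * lam) * Cbar (Suc t) \<omega> powr (1 - \<theta>)"
      using A_bounds \<beta>_pos by (intro mult_right_mono mult_left_mono) auto
    also have "\<dots> = \<beta> * (1 + b * lam) * Cbar t \<omega> powr (1 - \<theta>) * ec (Suc t) \<omega> powr (1 - \<theta>)"
      by (simp only: elim(1) mult.assoc)
    finally show ?case by linarith
  qed
  from cond_integrable_bound[OF * _ this] show ?thesis by (intro cond_integrableD(2)) measurable
qed

section \<open>The budget of an arbitrary admissible plan\<close>

context
  fixes C a :: "nat \<Rightarrow> 'a \<Rightarrow> real"
  assumes adm: "admissible M \<F> Rf S Cbar Div C a"
begin

abbreviation "W \<equiv> wealth Rf S Cbar Div C a"

lemma plan_measurable [measurable]:
  "C t \<in> borel_measurable (\<F> t)" "a t \<in> borel_measurable (\<F> t)"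
  using adm by (auto simp: admissible_def)

lemma plan_solvent: "AE \<omega> in M. 0 < C t \<omega>" "AE \<omega> in M. 0 \<le> W t \<omega> - C t \<omega>"
  using adm by (auto simp: admissible_def)

lemma wealth_measurable [measurable]: "W t \<in> borel_measurable (\<F> t)"
proof (induction t)
  case 0
  have "wealth Rf S Cbar Div C a 0 = (\<lambda>\<omega>. S 0 \<omega> + Div 0 \<omega> + (Cbar 0 \<omega> - Div 0 \<omega>))" by auto
  then show ?case by (simp del: atMost_0)
next
  case (Suc t)
  have up: "f \<in> borel_measurable (\<F> (Suc t))" if "f \<in> borel_measurable (\<F> t)" for f :: "'a \<Rightarrow> real"
    by (rule measurable_from_subalg[OF subalgebra_info_mono that]) auto
  have [measurable]: "W t \<in> borel_measurable (\<F> (Suc t))" "C t \<in> borel_measurable (\<F> (Suc t))"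
    "a t \<in> borel_measurable (\<F> (Suc t))" "Rf t \<in> borel_measurable (\<F> (Suc t))"
    by (intro up Suc plan_measurable asset_measurable)+
  have "wealth Rf S Cbar Div C a (Suc t) = (\<lambda>\<omega>. (W t \<omega> - C t \<omega>)
       * (a t \<omega> * stock_return S Div t \<omega> + (1 - a t \<omega>) * Rf t \<omega>) + (Cbar (Suc t) \<omega> - Div (Suc t) \<omega>))" by auto
  then show ?case by simp
qed

lemmas plan_measurable_M [measurable] = plan_measurable[THEN measurable_\<F>_M] wealth_measurable[THEN measurable_\<F>_M]

text \<open>In differences: next-period wealth in excess of \<open>Cbar + S\<close> is worth today's
  post-consumption wealth in excess of \<open>S\<close>. Each unit invested has value
  \<open>Q t\<close> in either asset, so the portfolio share drops out; labor income contributes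
  \<open>Cbar - Div\<close>, and \<open>Div\<close> is traded for \<open>S\<close> through the price
  of the stock. Solvency at \<open>Suc t\<close> makes next-period wealth nonnegative, so
  \<open>ennreal\<close> truncates nothing.\<close>

lemma budget:
  "AE \<omega> in M. nn_cond_exp M (\<F> t) (\<lambda>\<omega>. ennreal (\<beta> * Q (Suc t) \<omega> * W (Suc t) \<omega>)) \<omega> < \<infinity> \<and>
     nn_cond_exp M (\<F> t) (\<lambda>\<omega>. ennreal (\<beta> * Q (Suc t) \<omega> * W (Suc t) \<omega>)) \<omega> + ennreal (Q t \<omega> * S t \<omega>)
     = ennreal (Q t \<omega> * (W t \<omega> - C t \<omega>))
       + nn_cond_exp M (\<F> t) (\<lambda>\<omega>. ennreal (\<beta> * Q (Suc t) \<omega> * (Cbar (Suc t) \<omega> + S (Suc t) \<omega>))) \<omega>"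
proof -
  interpret sigma_finite_subalgebra M "\<F> t" by (rule sigma_finite_info)
  let ?E = "nn_cond_exp M (\<F> t)"
  define m where "m \<omega> = \<beta> * Q (Suc t) \<omega>" for \<omega>
  define X where "X \<omega> = W t \<omega> - C t \<omega>" for \<omega>
  \<comment> \<open>Long and short positions in stock and bond are separated, since the share has no
    sign restriction. Short positions and dividends will stand on the side of wealth, long positions
    and consumption opposite.\<close>
  define ap where "ap \<omega> = X \<omega> * max (a t \<omega>) 0" for \<omega>
  define am where "am \<omega> = X \<omega> * max (- a t \<omega>) 0" for \<omega>
  define cp where "cp \<omega> = X \<omega> * max (1 - a t \<omega>) 0" for \<omega>
  define cm where "cm \<omega> = X \<omega> * max (a t \<omega> - 1) 0" for \<omega>
  let ?w = "\<lambda>\<omega>. ennreal (m \<omega> * W (Suc t) \<omega>)" and ?d = "\<lambda>\<omega>. ennreal (m \<omega> * Div (Suc t) \<omega>)"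
  let ?c = "\<lambda>\<omega>. ennreal (m \<omega> * Cbar (Suc t) \<omega>)" and ?s = "\<lambda>\<omega>. ennreal (m \<omega> * S (Suc t) \<omega>)"
  let ?rs = "\<lambda>\<omega>. ennreal (m \<omega> * stock_return S Div t \<omega>)" and ?rf = "\<lambda>\<omega>. ennreal (m \<omega> * Rf t \<omega>)"
  have [measurable]: "m \<in> borel_measurable M" unfolding m_def[abs_def] by measurable
  have [measurable]: "X \<in> borel_measurable (\<F> t)" unfolding X_def[abs_def] by measurable
  have F[measurable]: "ap \<in> borel_measurable (\<F> t)" "am \<in> borel_measurable (\<F> t)"
    "cp \<in> borel_measurable (\<F> t)" "cm \<in> borel_measurable (\<F> t)"
    unfolding ap_def[abs_def] am_def[abs_def] cp_def[abs_def] cm_def[abs_def] by measurable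
  note [measurable] = F[THEN measurable_\<F>_M]
  have id: "ennreal w + (ennreal a1 * ennreal rs + (ennreal a2 * ennreal rf + ennreal d))
      = ennreal a3 * ennreal rs + (ennreal a4 * ennreal rf + ennreal c)"
    if "0 \<le> w" "0 \<le> d" "0 \<le> c" "0 \<le> rs" "0 \<le> rf" "0 \<le> a3" "0 \<le> a1" "0 \<le> a4" "0 \<le> a2"
      "w + (a1 * rs + (a2 * rf + d)) = a3 * rs + (a4 * rf + c)" for w a1 rs a2 rf d a3 a4 c
    using that by (simp flip: ennreal_mult ennreal_plus)
  have "AE \<omega> in M. 0 < m \<omega>" using Q_pos[of "Suc t"] by eventually_elim (use \<beta>_pos in \<open>simp add: m_def\<close>)
  then have "AE \<omega> in M. ?w \<omega> + (ennreal (am \<omega>) * ?rs \<omega> + (ennreal (cm \<omega>) * ?rf \<omega> + ?d \<omega>))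
      = ennreal (ap \<omega>) * ?rs \<omega> + (ennreal (cp \<omega>) * ?rf \<omega> + ?c \<omega>)"
    using plan_solvent[of t] plan_solvent[of "Suc t"] stock_return_pos[of t] AE_pos(3)[of "Suc t"] AE_pos(4)[of "Suc t"]
  proof eventually_elim
    case (elim \<omega>)
    have X: "0 \<le> X \<omega>" using elim(3) by (simp add: X_def)
    have nn: "0 \<le> m \<omega> * W (Suc t) \<omega>" "0 \<le> m \<omega> * Div (Suc t) \<omega>" "0 \<le> m \<omega> * Cbar (Suc t) \<omega>"
      "0 \<le> m \<omega> * stock_return S Div t \<omega>" "0 \<le> m \<omega> * Rf t \<omega>"
      "0 \<le> ap \<omega>" "0 \<le> am \<omega>" "0 \<le> cp \<omega>" "0 \<le> cm \<omega>"
      using elim Rf_pos[of t \<omega>] X by (auto simp: ap_def am_def cp_def cm_def simp del: wealth.simps)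
    have d: "ap \<omega> = am \<omega> + X \<omega> * a t \<omega>" "cp \<omega> = cm \<omega> + X \<omega> * (1 - a t \<omega>)"
      unfolding ap_def am_def cp_def cm_def by (auto simp: max_def algebra_simps)
    have "m \<omega> * W (Suc t) \<omega> + (am \<omega> * (m \<omega> * stock_return S Div t \<omega>) + (cm \<omega> * (m \<omega> * Rf t \<omega>) + m \<omega> * Div (Suc t) \<omega>))
      = ap \<omega> * (m \<omega> * stock_return S Div t \<omega>) + (cp \<omega> * (m \<omega> * Rf t \<omega>) + m \<omega> * Cbar (Suc t) \<omega>)"
      unfolding d by (simp add: X_def[symmetric]) (simp add: algebra_simps)
    with nn show ?case by (intro id)
  qed
  then have 0: "AE \<omega> in M. ?E (\<lambda>\<omega>. ?w \<omega> + (ennreal (am \<omega>) * ?rs \<omega> + (ennreal (cm \<omega>) * ?rf \<omega> + ?d \<omega>))) \<omega>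
      = ?E (\<lambda>\<omega>. ennreal (ap \<omega>) * ?rs \<omega> + (ennreal (cp \<omega>) * ?rf \<omega> + ?c \<omega>)) \<omega>"
    by (rule nn_cond_exp_cong) measurable
  have 1: "AE \<omega> in M. ?E (\<lambda>\<omega>. ?w \<omega> + (ennreal (am \<omega>) * ?rs \<omega> + (ennreal (cm \<omega>) * ?rf \<omega> + ?d \<omega>))) \<omega>
      = ?E ?w \<omega> + (?E (\<lambda>\<omega>. ennreal (am \<omega>) * ?rs \<omega>) \<omega> + (?E (\<lambda>\<omega>. ennreal (cm \<omega>) * ?rf \<omega>) \<omega> + ?E ?d \<omega>))"
    by (rule nn_cond_exp_sum4) auto
  have 2: "AE \<omega> in M. ?E (\<lambda>\<omega>. ennreal (ap \<omega>) * ?rs \<omega> + (ennreal (cp \<omega>) * ?rf \<omega> + ?c \<omega>)) \<omega>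
      = ?E (\<lambda>\<omega>. ennreal (ap \<omega>) * ?rs \<omega>) \<omega> + (?E (\<lambda>\<omega>. ennreal (cp \<omega>) * ?rf \<omega>) \<omega> + ?E ?c \<omega>)"
    by (rule nn_cond_exp_sum3) auto
  have rs: "AE \<omega> in M. ?E (\<lambda>\<omega>. ennreal (r \<omega>) * ?rs \<omega>) \<omega> = ennreal (r \<omega>) * ennreal (Q t \<omega>)"
    if "r \<in> borel_measurable (\<F> t)" for r
    using nn_cond_exp_prod[of "\<lambda>\<omega>. ennreal (r \<omega>)" ?rs] price_stock[of t] that by (auto simp: m_def)
  have rf: "AE \<omega> in M. ?E (\<lambda>\<omega>. ennreal (r \<omega>) * ?rf \<omega>) \<omega> = ennreal (r \<omega>) * ennreal (Q t \<omega>)"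
    if "r \<in> borel_measurable (\<F> t)" for r
    using nn_cond_exp_prod[of "\<lambda>\<omega>. ennreal (r \<omega>)" ?rf] price_bond[of t] that by (auto simp: m_def)
  have "AE \<omega> in M. ennreal (m \<omega> * (Cbar (Suc t) \<omega> + S (Suc t) \<omega>)) = ?c \<omega> + ?s \<omega>"
    using \<open>AE \<omega> in M. 0 < m \<omega>\<close> AE_pos(3)[of "Suc t"] S_pos[of "Suc t"]
    by eventually_elim (simp add: distrib_left ennreal_plus)
  then have "AE \<omega> in M. ?E (\<lambda>\<omega>. ennreal (m \<omega> * (Cbar (Suc t) \<omega> + S (Suc t) \<omega>))) \<omega> = ?E (\<lambda>\<omega>. ?c \<omega> + ?s \<omega>) \<omega>"
    by (rule nn_cond_exp_cong[OF eventually_mono]; (simp only: | measurable))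
  moreover have "AE \<omega> in M. ?E ?c \<omega> + ?E ?s \<omega> = ?E (\<lambda>\<omega>. ?c \<omega> + ?s \<omega>) \<omega>"
    by (rule nn_cond_exp_sum) auto
  ultimately have cs: "AE \<omega> in M. ?E (\<lambda>\<omega>. ennreal (m \<omega> * (Cbar (Suc t) \<omega> + S (Suc t) \<omega>))) \<omega> = ?E ?c \<omega> + ?E ?s \<omega>"
    by auto
  show ?thesis
    unfolding m_def[symmetric] X_def[symmetric]
    using 0 1 2 cs rs[OF F(1)] rs[OF F(2)] rf[OF F(3)] rf[OF F(4)]
      price_S_Div[of t, folded m_def] price_Cbar_finite[of t, folded m_def] Q_pos[of t] S_pos[of t] plan_solvent(2)[of t]
  proof eventually_elim
    case (elim \<omega>)
    have X: "0 \<le> X \<omega>" using elim(13) by (simp add: X_def)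
    have nn: "0 \<le> ap \<omega>" "0 \<le> am \<omega>" "0 \<le> cp \<omega>" "0 \<le> cm \<omega>" "0 \<le> Q t \<omega>" "0 \<le> S t \<omega>"
      using X elim(11,12) by (auto simp: ap_def am_def cp_def cm_def)
    \<comment> \<open>The values of stock, dividends and consumption are finite, and the equation
      forces the same for wealth; long and short positions can then be netted in real
      arithmetic.\<close>
    have "?E ?s \<omega> + ?E ?d \<omega> \<noteq> \<top>" unfolding elim(9) by simp
    then have fin: "?E ?s \<omega> < \<infinity>" "?E ?d \<omega> < \<infinity>"
      by (simp_all add: ennreal_add_eq_top less_top)
    obtain s where s: "?E ?s \<omega> = ennreal s" "0 \<le> s" using fin(1) by (cases "?E ?s \<omega>") auto
    obtain d where d: "?E ?d \<omega> = ennreal d" "0 \<le> d" using fin(2) by (cases "?E ?d \<omega>") auto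
    obtain c where c: "?E ?c \<omega> = ennreal c" "0 \<le> c" using elim(10) by (cases "?E ?c \<omega>") auto
    have eq: "?E ?w \<omega> + ennreal (am \<omega> * Q t \<omega> + (cm \<omega> * Q t \<omega> + d)) = ennreal (ap \<omega> * Q t \<omega> + (cp \<omega> * Q t \<omega> + c))"
      using elim(1-8) c d nn by (simp add: ennreal_mult ennreal_plus)
    have "?E ?w \<omega> + ennreal (am \<omega> * Q t \<omega> + (cm \<omega> * Q t \<omega> + d)) \<noteq> \<top>" unfolding eq by simp
    then have "?E ?w \<omega> < \<infinity>" by (simp add: ennreal_add_eq_top less_top)
    then obtain w where w: "?E ?w \<omega> = ennreal w" "0 \<le> w" by (cases "?E ?w \<omega>") auto
    have "w + (am \<omega> * Q t \<omega> + (cm \<omega> * Q t \<omega> + d)) = ap \<omega> * Q t \<omega> + (cp \<omega> * Q t \<omega> + c)"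
      using eq nn w c d by (simp flip: ennreal_plus)
    moreover have "ap \<omega> = am \<omega> + X \<omega> * a t \<omega>" "cp \<omega> = cm \<omega> + X \<omega> * (1 - a t \<omega>)"
      unfolding ap_def am_def cp_def cm_def by (auto simp: max_def algebra_simps)
    ultimately have wd: "w + d = X \<omega> * Q t \<omega> + c" by (simp add: algebra_simps)
    have sd: "s + d = Q t \<omega> * S t \<omega>" using elim(9) s d nn by (simp flip: ennreal_plus)
    have "w + Q t \<omega> * S t \<omega> = Q t \<omega> * X \<omega> + (c + s)" using wd sd by (simp add: mult.commute)
    from arg_cong[OF this, of ennreal] show ?case
      using elim(4) w c s nn X by (simp add: ennreal_plus)
  qed
qed

end

end

section \<open>Verification\<close>

context gain_loss_equilibrium
begin

section \<open>Iterated conditioning and transversality\<close>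

lemma \<F>_mono: "s \<le> t \<Longrightarrow> subalgebra (\<F> t) (\<F> s)"
  by (rule subalgebra_info_mono) auto

lemma nn_cond_exp_tower:
  assumes "f \<in> borel_measurable M"
  shows "AE \<omega> in M. nn_cond_exp M (\<F> t) f \<omega> = nn_cond_exp M (\<F> t) (nn_cond_exp M (\<F> (Suc t)) f) \<omega>"
proof -
  interpret sigma_finite_subalgebra M "\<F> t" by (rule sigma_finite_info)
  show ?thesis by (rule nn_cond_exp_nested_subalg[OF subalgebra_info \<F>_mono assms]) simp
qed

lemma nn_cond_exp_scale:
  assumes [measurable]: "f \<in> borel_measurable M"
  shows "AE \<omega> in M. nn_cond_exp M (\<F> t) (\<lambda>\<omega>. c * f \<omega>) \<omega> = c * nn_cond_exp M (\<F> t) f \<omega>"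
proof -
  interpret sigma_finite_subalgebra M "\<F> t" by (rule sigma_finite_info)
  show ?thesis using nn_cond_exp_prod[of "\<lambda>_. c" f] by auto
qed

text \<open>The largest value of \<open>\<beta> * k t\<close> compatible with
  \<open>(1 + b) * (\<beta> * k t) \<le> q t * (1 - \<beta> * k t)\<close>. As a function of
  \<open>q t\<close> alone it is constant over time, whereas \<open>\<beta> * k t\<close> may move
  with the state.\<close>

definition \<rho> :: "nat \<Rightarrow> 'a \<Rightarrow> real" where "\<rho> t \<omega> = q t \<omega> / (1 + b + q t \<omega>)"

lemma \<rho>_bounds: "AE \<omega> in M. 0 < \<rho> t \<omega> \<and> \<rho> t \<omega> < 1"
  using q_pos[of t] by eventually_elim (use b_nonneg in \<open>auto simp: \<rho>_def divide_simps\<close>)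

lemma \<rho>_measurable [measurable]: "\<rho> t \<in> borel_measurable (\<F> t)"
  unfolding \<rho>_def[abs_def] by measurable

lemma discount_le_\<rho>: "AE \<omega> in M. \<beta> * k t \<omega> \<le> \<rho> t \<omega>"
  using h_ge[of t] growth[of t] q_pos[of t]
proof eventually_elim
  case (elim \<omega>)
  have "(1 + b) * (\<beta> * k t \<omega>) \<le> \<beta> * h t \<omega>"
    using mult_left_mono[OF elim(1), of \<beta>] \<beta>_pos by (simp add: mult_ac)
  also have "\<beta> * h t \<omega> = q t \<omega> * (1 - \<beta> * k t \<omega>)" using elim(2) by (simp add: q_def)
  finally have "\<beta> * k t \<omega> * (1 + b + q t \<omega>) \<le> q t \<omega>" by (simp add: algebra_simps)
  moreover have "0 < 1 + b + q t \<omega>" using elim(3) b_nonneg by simp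
  ultimately show ?case by (simp add: \<rho>_def pos_le_divide_eq)
qed

text \<open>In the induction the bound from \<open>Suc t\<close> on contains a power of
  \<open>\<rho> (Suc t)\<close>, which equals \<open>\<rho> t\<close>, is known at \<open>t\<close>
  and leaves the expectation. The price of \<open>S (Suc t)\<close> then supplies the additional
  factor \<open>\<beta> * k t \<le> \<rho> t\<close>.\<close>

lemma transversality:
  "AE \<omega> in M. nn_cond_exp M (\<F> t) (\<lambda>\<omega>. ennreal (\<beta> ^ n * (Q (t + n) \<omega> * S (t + n) \<omega>))) \<omega>
     \<le> ennreal (\<rho> t \<omega> ^ n * (Q t \<omega> * S t \<omega>))"
proof (induction n arbitrary: t)
  case 0
  interpret sigma_finite_subalgebra M "\<F> t" by (rule sigma_finite_info)
  have "AE \<omega> in M. ennreal (Q t \<omega> * S t \<omega>) = nn_cond_exp M (\<F> t) (\<lambda>\<omega>. ennreal (Q t \<omega> * S t \<omega>)) \<omega>"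
    by (rule nn_cond_exp_F_meas) measurable
  then show ?case by eventually_elim simp
next
  case (Suc n)
  interpret s: sigma_finite_subalgebra M "\<F> t" by (rule sigma_finite_info)
  interpret s': sigma_finite_subalgebra M "\<F> (Suc t)" by (rule sigma_finite_info)
  let ?g = "\<lambda>\<omega>. ennreal (\<beta> ^ n * (Q (Suc t + n) \<omega> * S (Suc t + n) \<omega>))"
  let ?p = "\<lambda>\<omega>. ennreal (\<beta> * Q (Suc t) \<omega> * S (Suc t) \<omega>)"
  have g[measurable]: "?g \<in> borel_measurable M" by measurable
  have [measurable]: "\<rho> t \<in> borel_measurable M" by (rule measurable_\<F>_M) measurable
  have f: "(\<lambda>\<omega>. ennreal (\<beta> ^ Suc n * (Q (t + Suc n) \<omega> * S (t + Suc n) \<omega>))) = (\<lambda>\<omega>. ennreal \<beta> * ?g \<omega>)"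
    using \<beta>_pos by (simp add: fun_eq_iff mult.assoc less_imp_le flip: ennreal_mult')
  have "AE \<omega> in M. ennreal \<beta> * nn_cond_exp M (\<F> (Suc t)) ?g \<omega> \<le> ennreal (\<rho> t \<omega> ^ n) * ?p \<omega>"
    using Suc.IH[of "Suc t"] q_const[of t] \<rho>_bounds[of t] Q_pos[of "Suc t"] S_pos[of "Suc t"]
  proof eventually_elim
    case (elim \<omega>)
    have "\<rho> (Suc t) \<omega> = \<rho> t \<omega>" using elim(2) by (simp add: \<rho>_def)
    then have "ennreal \<beta> * nn_cond_exp M (\<F> (Suc t)) ?g \<omega> \<le> ennreal \<beta> * ennreal (\<rho> t \<omega> ^ n * (Q (Suc t) \<omega> * S (Suc t) \<omega>))"
      using elim(1) by (intro mult_left_mono) auto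
    also have "\<dots> = ennreal (\<rho> t \<omega> ^ n) * ?p \<omega>"
      using elim(3-5) \<beta>_pos by (simp add: mult_ac flip: ennreal_mult)
    finally show ?case .
  qed
  then have 1: "AE \<omega> in M. nn_cond_exp M (\<F> t) (\<lambda>\<omega>. ennreal \<beta> * nn_cond_exp M (\<F> (Suc t)) ?g \<omega>) \<omega>
      \<le> nn_cond_exp M (\<F> t) (\<lambda>\<omega>. ennreal (\<rho> t \<omega> ^ n) * ?p \<omega>) \<omega>"
    by (rule s.nn_cond_exp_mono) measurable
  have 2: "AE \<omega> in M. ennreal (\<rho> t \<omega> ^ n) * nn_cond_exp M (\<F> t) ?p \<omega>
      = nn_cond_exp M (\<F> t) (\<lambda>\<omega>. ennreal (\<rho> t \<omega> ^ n) * ?p \<omega>) \<omega>"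
    by (rule s.nn_cond_exp_prod) measurable
  have 3: "AE \<omega> in M. nn_cond_exp M (\<F> t) (\<lambda>\<omega>. ennreal \<beta> * nn_cond_exp M (\<F> (Suc t)) ?g \<omega>) \<omega>
     = ennreal \<beta> * nn_cond_exp M (\<F> t) (nn_cond_exp M (\<F> (Suc t)) ?g) \<omega>"
    by (rule nn_cond_exp_scale) measurable
  show ?case
    unfolding f
    using 1 2 3 nn_cond_exp_scale[OF g, of t "ennreal \<beta>"] nn_cond_exp_tower[OF g, of t] price_S[of t]
      discount_le_\<rho>[of t] \<rho>_bounds[of t] Q_pos[of t] S_pos[of t] k_pos[of t]
  proof eventually_elim
    case (elim \<omega>)
    have "nn_cond_exp M (\<F> t) (\<lambda>\<omega>. ennreal \<beta> * ?g \<omega>) \<omega> \<le> ennreal (\<rho> t \<omega> ^ n) * ennreal (\<beta> * k t \<omega> * (Q t \<omega> * S t \<omega>))"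
      using elim(1-6) by simp
    also have "\<dots> \<le> ennreal (\<rho> t \<omega> ^ n) * ennreal (\<rho> t \<omega> * (Q t \<omega> * S t \<omega>))"
      using elim(7-10) by (intro mult_left_mono ennreal_leI mult_right_mono) auto
    also have "\<dots> = ennreal (\<rho> t \<omega> ^ Suc n * (Q t \<omega> * S t \<omega>))"
      using elim(8-10) by (simp add: mult_ac flip: ennreal_mult)
    finally show ?case .
  qed
qed

text \<open>In the application \<open>f - g\<close> is, formally, the utility of the plan minus that
  of \<open>Cbar\<close>, with negative parts moved across. In the induction on the horizon the
  inequality from \<open>Suc t\<close> on is discounted and conditioned on date \<open>t\<close>,
  and the budget identity trades next-period wealth for today's. The last term is the value of the
  stock left at the horizon.\<close>

lemma verification_inequality:
  fixes f g :: "nat \<Rightarrow> 'a \<Rightarrow> ennreal"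
  assumes adm: "admissible M \<F> Rf S Cbar Div C a"
    and f: "\<And>t. f t \<in> borel_measurable (\<F> t)" and g: "\<And>t. g t \<in> borel_measurable (\<F> t)"
    and fg: "\<And>t. AE \<omega> in M. f t \<omega> + ennreal (Q t \<omega> * Cbar t \<omega>) \<le> g t \<omega> + ennreal (Q t \<omega> * C t \<omega>)"
  shows "AE \<omega> in M. nn_cond_exp M (\<F> t) (\<lambda>\<omega>. \<Sum>j<Suc n. ennreal (\<beta> ^ j) * f (t + j) \<omega>) \<omega>
       + ennreal (Q t \<omega> * (Cbar t \<omega> + S t \<omega>))
     \<le> nn_cond_exp M (\<F> t) (\<lambda>\<omega>. \<Sum>j<Suc n. ennreal (\<beta> ^ j) * g (t + j) \<omega>) \<omega>
       + ennreal (Q t \<omega> * wealth Rf S Cbar Div C a t \<omega>)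
       + nn_cond_exp M (\<F> t) (\<lambda>\<omega>. ennreal (\<beta> ^ n * (Q (t + n) \<omega> * S (t + n) \<omega>))) \<omega>"
proof (induction n arbitrary: t)
  case 0
  interpret sigma_finite_subalgebra M "\<F> t" by (rule sigma_finite_info)
  have 1: "AE \<omega> in M. f t \<omega> = nn_cond_exp M (\<F> t) (f t) \<omega>" by (rule nn_cond_exp_F_meas[OF f])
  have 2: "AE \<omega> in M. g t \<omega> = nn_cond_exp M (\<F> t) (g t) \<omega>" by (rule nn_cond_exp_F_meas[OF g])
  have 3: "AE \<omega> in M. ennreal (Q t \<omega> * S t \<omega>) = nn_cond_exp M (\<F> t) (\<lambda>\<omega>. ennreal (Q t \<omega> * S t \<omega>)) \<omega>"
    by (rule nn_cond_exp_F_meas) measurable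
  show ?case
    using 1 2 3 fg[of t] Q_pos[of t] S_pos[of t] AE_pos(3)[of t] plan_solvent[OF adm, of t]
  proof eventually_elim
    case (elim \<omega>)
    have "ennreal (Q t \<omega> * (Cbar t \<omega> + S t \<omega>)) = ennreal (Q t \<omega> * Cbar t \<omega>) + ennreal (Q t \<omega> * S t \<omega>)"
      using elim(5-7) by (simp add: distrib_left)
    then have "f t \<omega> + ennreal (Q t \<omega> * (Cbar t \<omega> + S t \<omega>)) \<le> (g t \<omega> + ennreal (Q t \<omega> * C t \<omega>)) + ennreal (Q t \<omega> * S t \<omega>)"
      using elim(4) by (simp add: add.assoc[symmetric] add_right_mono)
    \<comment> \<open>Solvency at the horizon: consumption does not exceed wealth.\<close>
    also have "\<dots> \<le> (g t \<omega> + ennreal (Q t \<omega> * wealth Rf S Cbar Div C a t \<omega>)) + ennreal (Q t \<omega> * S t \<omega>)"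
      using elim(5,8,9) by (intro add_mono order_refl ennreal_leI mult_left_mono) auto
    finally show ?case using elim(1-3) by simp
  qed
next
  case (Suc n)
  interpret s: sigma_finite_subalgebra M "\<F> t" by (rule sigma_finite_info)
  let ?E = "nn_cond_exp M (\<F> t)" and ?E' = "nn_cond_exp M (\<F> (Suc t))"
  let ?W = "wealth Rf S Cbar Div C a"
  let ?sum = "\<lambda>f \<omega>. \<Sum>j<Suc n. ennreal (\<beta> ^ j) * f (Suc t + j) \<omega>"
  let ?r = "\<lambda>\<omega>. ennreal (\<beta> ^ n * (Q (Suc t + n) \<omega> * S (Suc t + n) \<omega>))"
  let ?c = "\<lambda>\<omega>. ennreal (Q (Suc t) \<omega> * (Cbar (Suc t) \<omega> + S (Suc t) \<omega>))" and ?w = "\<lambda>\<omega>. ennreal (Q (Suc t) \<omega> * ?W (Suc t) \<omega>)"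
  have fM[measurable]: "f j \<in> borel_measurable M" and gM[measurable]: "g j \<in> borel_measurable M" for j
    using measurable_from_subalg[OF subalgebra_info f] measurable_from_subalg[OF subalgebra_info g] by auto
  have WM[measurable]: "?W j \<in> borel_measurable M" for j
    by (rule measurable_\<F>_M[OF wealth_measurable[OF adm]])
  have [measurable]: "?sum f \<in> borel_measurable M" "?sum g \<in> borel_measurable M" "?r \<in> borel_measurable M"
    by measurable
  \<comment> \<open>The first term is known at \<open>t\<close>. The remaining sum, reindexed from
    \<open>Suc t\<close>, has a common factor \<open>\<beta>\<close> and is conditioned through date
    \<open>Suc t\<close> by the tower property.\<close>
  have unfold_sum: "AE \<omega> in M. ?E (\<lambda>\<omega>. \<Sum>j<Suc (Suc n). ennreal (\<beta> ^ j) * e (t + j) \<omega>) \<omega>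
      = e t \<omega> + ennreal \<beta> * ?E (?E' (?sum e)) \<omega>"
    if eF: "\<And>t. e t \<in> borel_measurable (\<F> t)" for e :: "nat \<Rightarrow> 'a \<Rightarrow> ennreal"
  proof -
    have [measurable]: "e j \<in> borel_measurable M" for j by (rule measurable_from_subalg[OF subalgebra_info eF])
    have m[measurable]: "?sum e \<in> borel_measurable M" by measurable
    have "(\<lambda>\<omega>. \<Sum>j<Suc (Suc n). ennreal (\<beta> ^ j) * e (t + j) \<omega>) = (\<lambda>\<omega>. e t \<omega> + ennreal \<beta> * ?sum e \<omega>)"
      unfolding sum.lessThan_Suc_shift[of _ "Suc n"] sum_distrib_left using \<beta>_pos
      by (simp add: fun_eq_iff ennreal_mult' mult.assoc less_imp_le del: sum.lessThan_Suc)
    moreover have "AE \<omega> in M. ?E (e t) \<omega> + ?E (\<lambda>\<omega>. ennreal \<beta> * ?sum e \<omega>) \<omega> = ?E (\<lambda>\<omega>. e t \<omega> + ennreal \<beta> * ?sum e \<omega>) \<omega>"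
      by (rule s.nn_cond_exp_sum) measurable
    ultimately show ?thesis
      using s.nn_cond_exp_F_meas[OF eF] nn_cond_exp_scale[OF m, of t "ennreal \<beta>"] nn_cond_exp_tower[OF m, of t]
      by auto
  qed
  have "AE \<omega> in M. ennreal \<beta> * ?E' (?sum f) \<omega> + ennreal \<beta> * ?c \<omega>
      \<le> ennreal \<beta> * ?E' (?sum g) \<omega> + (ennreal \<beta> * ?w \<omega> + ennreal \<beta> * ?E' ?r \<omega>)"
    using Suc.IH[of "Suc t"]
  proof eventually_elim
    case (elim \<omega>)
    from mult_left_mono[OF elim, of "ennreal \<beta>"] show ?case by (simp only: distrib_left add.assoc zero_le)
  qed
  then have 1: "AE \<omega> in M. ?E (\<lambda>\<omega>. ennreal \<beta> * ?E' (?sum f) \<omega> + ennreal \<beta> * ?c \<omega>) \<omega>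
      \<le> ?E (\<lambda>\<omega>. ennreal \<beta> * ?E' (?sum g) \<omega> + (ennreal \<beta> * ?w \<omega> + ennreal \<beta> * ?E' ?r \<omega>)) \<omega>"
    by (rule s.nn_cond_exp_mono) measurable
  have 2: "AE \<omega> in M. ?E (\<lambda>\<omega>. ennreal \<beta> * ?E' (?sum f) \<omega>) \<omega> + ?E (\<lambda>\<omega>. ennreal \<beta> * ?c \<omega>) \<omega>
      = ?E (\<lambda>\<omega>. ennreal \<beta> * ?E' (?sum f) \<omega> + ennreal \<beta> * ?c \<omega>) \<omega>"
    by (rule s.nn_cond_exp_sum) measurable
  have 3: "AE \<omega> in M. ?E (\<lambda>\<omega>. ennreal \<beta> * ?E' (?sum g) \<omega> + (ennreal \<beta> * ?w \<omega> + ennreal \<beta> * ?E' ?r \<omega>)) \<omega>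
      = ?E (\<lambda>\<omega>. ennreal \<beta> * ?E' (?sum g) \<omega>) \<omega> + (?E (\<lambda>\<omega>. ennreal \<beta> * ?w \<omega>) \<omega> + ?E (\<lambda>\<omega>. ennreal \<beta> * ?E' ?r \<omega>) \<omega>)"
    by (rule s.nn_cond_exp_sum3) measurable
  have sc: "AE \<omega> in M. ?E (\<lambda>\<omega>. ennreal \<beta> * ?E' e \<omega>) \<omega> = ennreal \<beta> * ?E (?E' e) \<omega>" for e
    by (rule nn_cond_exp_scale) measurable
  have \<beta>m: "ennreal \<beta> * ennreal (x * y) = ennreal (\<beta> * x * y)" for x y
    using \<beta>_pos by (simp add: mult.assoc less_imp_le flip: ennreal_mult')
  have r: "(\<lambda>\<omega>. ennreal (\<beta> ^ Suc n * (Q (t + Suc n) \<omega> * S (t + Suc n) \<omega>))) = (\<lambda>\<omega>. ennreal \<beta> * ?r \<omega>)"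
    using \<beta>_pos by (simp add: fun_eq_iff mult.assoc less_imp_le flip: ennreal_mult')
  have 4: "AE \<omega> in M. ?E (\<lambda>\<omega>. ennreal \<beta> * ?r \<omega>) \<omega> = ennreal \<beta> * ?E (?E' ?r) \<omega>"
    using nn_cond_exp_scale[of ?r t "ennreal \<beta>"] nn_cond_exp_tower[of ?r t] by auto
  show ?case
    unfolding r
    using unfold_sum[OF f] unfold_sum[OF g] 1 2 3 sc[of "?sum f"] sc[of "?sum g"] sc[of ?r] 4
      budget[OF adm, of t] fg[of t] Q_pos[of t] S_pos[of t] AE_pos(3)[of t] plan_solvent[OF adm, of t]
  proof eventually_elim
    case (elim \<omega>)
    let ?\<phi> = "ennreal \<beta> * ?E (?E' (?sum f)) \<omega>" and ?\<gamma> = "ennreal \<beta> * ?E (?E' (?sum g)) \<omega>"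
    let ?\<tau> = "ennreal \<beta> * ?E (?E' ?r) \<omega>"
    have 0: "?\<phi> + ?E (\<lambda>\<omega>. ennreal \<beta> * ?c \<omega>) \<omega> \<le> ?\<gamma> + ?E (\<lambda>\<omega>. ennreal \<beta> * ?w \<omega>) \<omega> + ?\<tau>"
      using elim(3-8) by (simp only: add.assoc)
    \<comment> \<open>Next-period wealth and its benchmark \<open>Cbar + S\<close> disappear
      together; what remains are values known at \<open>t\<close>.\<close>
    have *: "?\<phi> + ennreal (Q t \<omega> * S t \<omega>) \<le> ?\<gamma> + ennreal (Q t \<omega> * (?W t \<omega> - C t \<omega>)) + ?\<tau>"
      by (rule ennreal_budget_cancel[OF 0[unfolded \<beta>m] conjunct2[OF elim(10)] conjunct1[OF elim(10)]])
    have "f t \<omega> + ?\<phi> + ennreal (Q t \<omega> * (Cbar t \<omega> + S t \<omega>))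
        = (f t \<omega> + ennreal (Q t \<omega> * Cbar t \<omega>)) + (?\<phi> + ennreal (Q t \<omega> * S t \<omega>))"
      using elim(12-14) by (simp add: distrib_left ac_simps)
    also have "\<dots> \<le> (g t \<omega> + ennreal (Q t \<omega> * C t \<omega>)) + (?\<gamma> + ennreal (Q t \<omega> * (?W t \<omega> - C t \<omega>)) + ?\<tau>)"
      by (rule add_mono[OF elim(11) *])
    also have "\<dots> = g t \<omega> + ?\<gamma> + (ennreal (Q t \<omega> * C t \<omega>) + ennreal (Q t \<omega> * (?W t \<omega> - C t \<omega>))) + ?\<tau>"
      by (simp only: ac_simps)
    also have "ennreal (Q t \<omega> * C t \<omega>) + ennreal (Q t \<omega> * (?W t \<omega> - C t \<omega>)) = ennreal (Q t \<omega> * ?W t \<omega>)"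
      using elim(12,15,16) by (simp add: right_diff_distrib flip: ennreal_plus)
    finally show ?case unfolding elim(1,2,9) .
  qed
qed

text \<open>After consuming \<open>Cbar\<close> the agent holds exactly one share. Its payoff is
  price plus dividend, and labor income raises the dividend to \<open>Cbar\<close>.\<close>

lemma wealth_eq:
  assumes "\<forall>s<t. AE \<omega> in M. C s \<omega> = Cbar s \<omega> \<and> a s \<omega> = 1"
  shows "AE \<omega> in M. wealth Rf S Cbar Div C a t \<omega> = Cbar t \<omega> + S t \<omega>"
  using assms
proof (induction t)
  case (Suc t)
  then have "AE \<omega> in M. wealth Rf S Cbar Div C a t \<omega> = Cbar t \<omega> + S t \<omega>"
    and "AE \<omega> in M. C t \<omega> = Cbar t \<omega> \<and> a t \<omega> = 1" by auto
  then show ?case using S_pos[of t]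
    by eventually_elim (simp add: stock_return_def)
qed simp

section \<open>Optimality of aggregate consumption\<close>

lemma admissible_Cbar: "admissible M \<F> Rf S Cbar Div Cbar (\<lambda>_ _. 1)"
  unfolding admissible_def
proof (intro allI conjI)
  fix t
  have "AE \<omega> in M. wealth Rf S Cbar Div Cbar (\<lambda>_ _. 1) t \<omega> = Cbar t \<omega> + S t \<omega>"
    by (rule wealth_eq) auto
  then show "AE \<omega> in M. 0 < Cbar t \<omega> \<and> 0 \<le> wealth Rf S Cbar Div Cbar (\<lambda>_ _. 1) t \<omega> - Cbar t \<omega>"
    using S_pos[of t] AE_pos(3)[of t] by eventually_elim simp
qed measurable

lemma utility_measurable:
  assumes [measurable]: "C s \<in> borel_measurable (\<F> s)"
  shows "utility C s \<in> borel_measurable (\<F> s)"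
  unfolding period_utility_def[abs_def] by measurable

text \<open>Nonnegativity lets two conditional expectations of series be merged into one series of
  conditional expectations, whose partial sums are those of the finite-horizon inequality.\<close>

lemma discounted_gain_add:
  assumes [measurable]: "\<And>s. u s \<in> borel_measurable M" "\<And>s. v s \<in> borel_measurable M"
  shows "AE \<omega> in M. discounted_gain M (\<F> t) \<beta> u t \<omega> + discounted_gain M (\<F> t) \<beta> v t \<omega>
    = (\<Sum>j. nn_cond_exp M (\<F> t) (\<lambda>\<omega>. ennreal (\<beta> ^ j) * (ennreal (u (t + j) \<omega>) + ennreal (v (t + j) \<omega>))) \<omega>)"
proof -
  interpret sigma_finite_subalgebra M "\<F> t" by (rule sigma_finite_info)
  have "(\<Sum>j. ennreal (\<beta> ^ j * u (t + j) \<omega>)) + (\<Sum>j. ennreal (\<beta> ^ j * v (t + j) \<omega>))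
      = (\<Sum>j. ennreal (\<beta> ^ j) * (ennreal (u (t + j) \<omega>) + ennreal (v (t + j) \<omega>)))" for \<omega>
    using \<beta>_pos by (subst suminf_add) (auto simp: distrib_left ennreal_mult' less_imp_le)
  moreover have "AE \<omega> in M. discounted_gain M (\<F> t) \<beta> u t \<omega> + discounted_gain M (\<F> t) \<beta> v t \<omega>
      = nn_cond_exp M (\<F> t) (\<lambda>\<omega>. (\<Sum>j. ennreal (\<beta> ^ j * u (t + j) \<omega>)) + (\<Sum>j. ennreal (\<beta> ^ j * v (t + j) \<omega>))) \<omega>"
    unfolding discounted_gain_def by (rule nn_cond_exp_sum) measurable
  moreover have "AE \<omega> in M. (\<Sum>j. nn_cond_exp M (\<F> t) (\<lambda>\<omega>. ennreal (\<beta> ^ j) * (ennreal (u (t + j) \<omega>) + ennreal (v (t + j) \<omega>))) \<omega>)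
      = nn_cond_exp M (\<F> t) (\<lambda>\<omega>. \<Sum>j. ennreal (\<beta> ^ j) * (ennreal (u (t + j) \<omega>) + ennreal (v (t + j) \<omega>))) \<omega>"
    by (rule nn_cond_exp_suminf) measurable
  ultimately show ?thesis by auto
qed

text \<open>The limit over the horizon is taken while positive and negative parts stand on opposite
  sides. The comparison becomes one of extended reals only at the end, where definedness of both
  lifetime utilities excludes infinity minus infinity.\<close>

lemma lifetime_utility_le:
  assumes adm: "admissible M \<F> Rf S Cbar Div C a"
    and past: "\<forall>s<t. AE \<omega> in M. C s \<omega> = Cbar s \<omega> \<and> a s \<omega> = 1"
    and defined: "AE \<omega> in M. lifetime_defined M (\<F> t) \<beta> (utility Cbar) t \<omega>"
  shows "AE \<omega> in M. lifetime_defined M (\<F> t) \<beta> (utility C) t \<omega> \<longrightarrow>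
    lifetime_utility M (\<F> t) \<beta> (utility C) t \<omega> \<le> lifetime_utility M (\<F> t) \<beta> (utility Cbar) t \<omega>"
proof -
  interpret sigma_finite_subalgebra M "\<F> t" by (rule sigma_finite_info)
  define u v where "u = utility C" and "v = utility Cbar"
  have uF[measurable]: "u s \<in> borel_measurable (\<F> s)" and vF[measurable]: "v s \<in> borel_measurable (\<F> s)" for s
    unfolding u_def v_def by (intro utility_measurable plan_measurable[OF adm] measurable_\<F>)+
  note [measurable] = measurable_\<F>_M[OF uF] measurable_\<F>_M[OF vF]
  define f g where "f s \<omega> = ennreal (u s \<omega>) + ennreal (- v s \<omega>)" and "g s \<omega> = ennreal (v s \<omega>) + ennreal (- u s \<omega>)" for s \<omega>
  have fF: "f s \<in> borel_measurable (\<F> s)" and gF: "g s \<in> borel_measurable (\<F> s)" for s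
    unfolding f_def[abs_def] g_def[abs_def] by measurable
  note [measurable] = fF[THEN measurable_from_subalg[OF subalgebra_info]] gF[THEN measurable_from_subalg[OF subalgebra_info]]
  have fg: "AE \<omega> in M. f s \<omega> + ennreal (Q s \<omega> * Cbar s \<omega>) \<le> g s \<omega> + ennreal (Q s \<omega> * C s \<omega>)" for s
    using utility_le_tangent[where C=C, OF plan_measurable(1)[OF adm, of s] plan_solvent(1)[OF adm, of s]]
      Q_pos[of s] AE_pos(3)[of s] plan_solvent(1)[OF adm, of s]
  proof eventually_elim
    case (elim \<omega>)
    then show ?case unfolding f_def g_def u_def v_def
      by (intro ennreal_utility_transfer) (auto simp: right_diff_distrib)
  qed
  let ?E = "nn_cond_exp M (\<F> t)"
  let ?e = "\<lambda>f j. ?E (\<lambda>\<omega>. ennreal (\<beta> ^ j) * f (t + j) \<omega>)"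
  \<comment> \<open>The horizons are countable, so all of them share one null set and the limit can
    be taken at a fixed \<omega>.\<close>
  have "AE \<omega> in M. \<forall>n. ?E (\<lambda>\<omega>. \<Sum>j<Suc n. ennreal (\<beta> ^ j) * f (t + j) \<omega>) \<omega>
       + ennreal (Q t \<omega> * (Cbar t \<omega> + S t \<omega>))
     \<le> ?E (\<lambda>\<omega>. \<Sum>j<Suc n. ennreal (\<beta> ^ j) * g (t + j) \<omega>) \<omega>
       + ennreal (Q t \<omega> * wealth Rf S Cbar Div C a t \<omega>)
       + ?E (\<lambda>\<omega>. ennreal (\<beta> ^ n * (Q (t + n) \<omega> * S (t + n) \<omega>))) \<omega>"
    unfolding AE_all_countable by (intro allI verification_inequality[OF adm fF gF fg])
  moreover have "AE \<omega> in M. \<forall>n. ?E (\<lambda>\<omega>. ennreal (\<beta> ^ n * (Q (t + n) \<omega> * S (t + n) \<omega>))) \<omega>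
      \<le> ennreal (\<rho> t \<omega> ^ n * (Q t \<omega> * S t \<omega>))"
    unfolding AE_all_countable by (intro allI transversality)
  moreover have "AE \<omega> in M. \<forall>n. (\<Sum>j<Suc n. ?e f j \<omega>) = ?E (\<lambda>\<omega>. \<Sum>j<Suc n. ennreal (\<beta> ^ j) * f (t + j) \<omega>) \<omega>"
    unfolding AE_all_countable by (intro allI nn_cond_exp_finite_sum) measurable
  moreover have "AE \<omega> in M. \<forall>n. (\<Sum>j<Suc n. ?e g j \<omega>) = ?E (\<lambda>\<omega>. \<Sum>j<Suc n. ennreal (\<beta> ^ j) * g (t + j) \<omega>) \<omega>"
    unfolding AE_all_countable by (intro allI nn_cond_exp_finite_sum) measurable
  moreover have "AE \<omega> in M. discounted_gain M (\<F> t) \<beta> u t \<omega> + discounted_gain M (\<F> t) \<beta> (\<lambda>s \<omega>. - v s \<omega>) t \<omega> = (\<Sum>j. ?e f j \<omega>)"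
    unfolding f_def by (rule discounted_gain_add) measurable
  moreover have "AE \<omega> in M. discounted_gain M (\<F> t) \<beta> v t \<omega> + discounted_gain M (\<F> t) \<beta> (\<lambda>s \<omega>. - u s \<omega>) t \<omega> = (\<Sum>j. ?e g j \<omega>)"
    unfolding g_def by (rule discounted_gain_add) measurable
  ultimately show ?thesis
    unfolding u_def[symmetric] v_def[symmetric]
    using wealth_eq[OF past] \<rho>_bounds[of t] defined[folded v_def]
  proof eventually_elim
    case (elim \<omega>)
    have "(\<Sum>j<Suc n. ?e f j \<omega>) \<le> (\<Sum>j. ?e g j \<omega>) + ennreal (\<rho> t \<omega> ^ n * (Q t \<omega> * S t \<omega>))" for n
    proof -
      let ?z = "ennreal (Q t \<omega> * (Cbar t \<omega> + S t \<omega>))"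
      \<comment> \<open>The plan agrees with the candidate before \<open>t\<close>, so both start
        from the same wealth at \<open>t\<close>; its value \<open>?z\<close> is finite and
        cancels.\<close>
      have "(\<Sum>j<Suc n. ?e f j \<omega>) + ?z \<le> (\<Sum>j<Suc n. ?e g j \<omega>) + ?z
          + ?E (\<lambda>\<omega>. ennreal (\<beta> ^ n * (Q (t + n) \<omega> * S (t + n) \<omega>))) \<omega>"
        using spec[OF elim(1), of n] unfolding elim(7) spec[OF elim(3), of n] spec[OF elim(4), of n] .
      then have "(\<Sum>j<Suc n. ?e f j \<omega>) \<le> (\<Sum>j<Suc n. ?e g j \<omega>)
          + ?E (\<lambda>\<omega>. ennreal (\<beta> ^ n * (Q (t + n) \<omega> * S (t + n) \<omega>))) \<omega>"
        by (subst (asm) (1 2) add.commute) (simp add: ennreal_add_left_cancel_le add.assoc)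
      also have "\<dots> \<le> (\<Sum>j. ?e g j \<omega>) + ennreal (\<rho> t \<omega> ^ n * (Q t \<omega> * S t \<omega>))"
        using elim(2) by (intro add_mono sum_le_suminf) auto
      finally show ?thesis .
    qed
    moreover have "(\<lambda>n. \<Sum>j<Suc n. ?e f j \<omega>) \<longlonglongrightarrow> (\<Sum>j. ?e f j \<omega>)"
      by (intro LIMSEQ_Suc summable_LIMSEQ summableI)
    moreover have "(\<lambda>n. (\<Sum>j. ?e g j \<omega>) + ennreal (\<rho> t \<omega> ^ n * (Q t \<omega> * S t \<omega>)))
        \<longlonglongrightarrow> (\<Sum>j. ?e g j \<omega>) + ennreal (0 * (Q t \<omega> * S t \<omega>))"
      using elim(8) by (intro tendsto_add tendsto_const tendsto_ennrealI tendsto_mult LIMSEQ_power_zero) auto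
    ultimately have "(\<Sum>j. ?e f j \<omega>) \<le> (\<Sum>j. ?e g j \<omega>) + ennreal (0 * (Q t \<omega> * S t \<omega>))"
      by (intro LIMSEQ_le) auto
    then have "discounted_gain M (\<F> t) \<beta> u t \<omega> + discounted_gain M (\<F> t) \<beta> (\<lambda>s \<omega>. - v s \<omega>) t \<omega>
        \<le> discounted_gain M (\<F> t) \<beta> v t \<omega> + discounted_gain M (\<F> t) \<beta> (\<lambda>s \<omega>. - u s \<omega>) t \<omega>"
      unfolding elim(5,6) by simp
    then show ?case
      using elim(9) unfolding lifetime_defined_def lifetime_utility_def
      by (intro impI ereal_diff_le_diff) auto
  qed
qed

section \<open>Equilibrium, stock return and risk premium\<close>

lemma equilibrium_exists:
  assumes "\<And>t. AE \<omega> in M. lifetime_defined M (\<F> t) \<beta> (utility Cbar) t \<omega>"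
  shows "equilibrium M c0 d0 ec ed \<theta> \<beta> b lam reference Rf S"
proof -
  have "optimal_plan M \<F> \<theta> \<beta> b lam reference Rf S Cbar Div Cbar (\<lambda>_ _. 1)"
    unfolding optimal_plan_def Let_def
    using admissible_Cbar assms lifetime_utility_le by blast
  then show ?thesis
    unfolding equilibrium_def Let_def
    using S_pos cond_indep_reference cond_ident_distr_reference
    by (intro conjI allI exI[of _ Cbar] exI[of _ "\<lambda>_ _. 1"]) (auto intro: asset_measurable reference_measurable)
qed

text \<open>The resale part of the return carries the ratio \<open>q (Suc t) / q t\<close> in front
  of \<open>1 / A (ec (Suc t))\<close>. All other factors being positive, the formula holds exactly
  where this ratio is \<open>1\<close>.\<close>

lemma stock_return_eq:
  "AE \<omega> in M. stock_return S Div t \<omega> = A (ec t \<omega>) * ed (Suc t) \<omega>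
     * ((1 - \<beta> * k t \<omega>) / (\<beta> * h t \<omega>) + 1 / A (ec (Suc t) \<omega>))"
  using q_pos[of t] q_const[of t] AE_pos(4)[of t]
proof eventually_elim
  case (elim \<omega>)
  have A: "0 < A (ec t \<omega>)" "0 < A (ec (Suc t) \<omega>)" by (rule A_bounds)+
  have e: "(1 - \<beta> * k t \<omega>) / (\<beta> * h t \<omega>) = 1 / q t \<omega>" by (simp add: q_def)
  show ?case
    unfolding e using elim A by (simp add: stock_return_def S_def level_Suc divide_simps) (simp add: algebra_simps)
qed

text \<open>Since \<open>A\<close> is at least \<open>1\<close>, conditional integrability of
  dividend growth passes to its quotient by \<open>A\<close>, and the return is a combination of
  these two with coefficients known at \<open>t\<close>. The last term is the bond return, as the
  conditional mean in it is the constant \<open>K\<close>.\<close>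

lemma risk_premium:
  assumes ed: "cond_integrable M (\<F> t) (ed (Suc t))"
  shows "cond_integrable M (\<F> t) (stock_return S Div t)"
    "AE \<omega> in M. real_cond_exp M (\<F> t) (stock_return S Div t) \<omega> - Rf t \<omega> = A (ec t \<omega>) *
       (real_cond_exp M (\<F> t) (\<lambda>\<omega>. ed (Suc t) \<omega> / A (ec (Suc t) \<omega>)) \<omega>
        + real_cond_exp M (\<F> t) (ed (Suc t)) \<omega> * (1 - \<beta> * k t \<omega>) / (\<beta> * h t \<omega>)
        - 1 / (\<beta> * real_cond_exp M (\<F> t) (\<lambda>\<omega>. ec (Suc t) \<omega> powr (- \<theta>) * A (ec (Suc t) \<omega>)) \<omega>))"
proof -
  interpret sigma_finite_subalgebra M "\<F> t" by (rule sigma_finite_info)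
  let ?c = "\<lambda>\<omega>. A (ec t \<omega>) * ((1 - \<beta> * k t \<omega>) / (\<beta> * h t \<omega>))" and ?X = "\<lambda>\<omega>. ed (Suc t) \<omega> / A (ec (Suc t) \<omega>)"
  have c: "?c \<in> borel_measurable (\<F> t)" and a: "(\<lambda>\<omega>. A (ec t \<omega>)) \<in> borel_measurable (\<F> t)" by measurable
  have X: "cond_integrable M (\<F> t) ?X"
  proof (rule cond_integrable_bound[OF ed])
    have "\<bar>x / A y\<bar> \<le> \<bar>x\<bar>" for x y
      using A_bounds[of y] b_nonneg by (simp add: abs_divide divide_le_eq mult_le_cancel_left1)
    then show "AE \<omega> in M. \<bar>?X \<omega>\<bar> \<le> \<bar>ed (Suc t) \<omega>\<bar>" by simp
  qed measurable
  note 1 = cond_integrable_mult[OF ed c] and 2 = cond_integrable_mult[OF X a]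
  have eq: "AE \<omega> in M. stock_return S Div t \<omega> = ?c \<omega> * ed (Suc t) \<omega> + A (ec t \<omega>) * ?X \<omega>"
    using stock_return_eq[of t] by eventually_elim (simp add: algebra_simps)
  then show "cond_integrable M (\<F> t) (stock_return S Div t)"
    by (intro cond_integrable_bound[OF cond_integrable_add(1)[OF 1(1) 2(1)]]) auto
  have "AE \<omega> in M. real_cond_exp M (\<F> t) (stock_return S Div t) \<omega>
      = real_cond_exp M (\<F> t) (\<lambda>\<omega>. ?c \<omega> * ed (Suc t) \<omega> + A (ec t \<omega>) * ?X \<omega>) \<omega>"
    using eq by (rule real_cond_exp_cong) measurable
  then show "AE \<omega> in M. real_cond_exp M (\<F> t) (stock_return S Div t) \<omega> - Rf t \<omega> = A (ec t \<omega>) *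
       (real_cond_exp M (\<F> t) ?X \<omega> + real_cond_exp M (\<F> t) (ed (Suc t)) \<omega> * (1 - \<beta> * k t \<omega>) / (\<beta> * h t \<omega>)
        - 1 / (\<beta> * real_cond_exp M (\<F> t) (\<lambda>\<omega>. ec (Suc t) \<omega> powr (- \<theta>) * A (ec (Suc t) \<omega>)) \<omega>))"
    using cond_integrable_add(2)[OF 1(1) 2(1)] 1(2) 2(2) real_cond_exp_ec_A[of t]
  proof eventually_elim
    case (elim \<omega>)
    show ?case unfolding elim by (simp add: Rf_def algebra_simps)
  qed
qed

end

theorem theorem2:
  fixes M :: "'a measure" and c0 d0 \<theta> \<beta> b lam :: real
    and ec ed etil R :: "nat \<Rightarrow> 'a \<Rightarrow> real"
    and F :: "nat \<Rightarrow> 'a measure" and E :: "nat \<Rightarrow> ('a \<Rightarrow> real) \<Rightarrow> 'a \<Rightarrow> real"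
    and Feps A :: "real \<Rightarrow> real" and k h :: "nat \<Rightarrow> 'a \<Rightarrow> real"
  assumes economy: "endowment_economy M c0 d0 ec ed etil"
    and params: "\<theta> > 0" "\<beta> > 0" "b \<ge> 0" "lam \<ge> 1"
    \<comment> \<open>notation\<close>
    and F: "\<And>t. F t = info M ec ed {..t}"
    and E: "\<And>t X. E t X = real_cond_exp M (F t) X"
    and Feps: "Feps = cdf (distr M borel (ec 0))"
    and A: "\<And>x. A x = 1 + b * Feps x + b * lam * (1 - Feps x)"
    and R: "\<And>t \<omega>. R t \<omega> = prev_level c0 ec t \<omega> * etil t \<omega>"
    and k: "\<And>t. k t = E t (\<lambda>\<omega>. ec (Suc t) \<omega> powr (- \<theta>) * ed (Suc t) \<omega>)"
    and h: "\<And>t. h t = E t (\<lambda>\<omega>. ec (Suc t) \<omega> powr (- \<theta>) * ed (Suc t) \<omega> * A (ec (Suc t) \<omega>))"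
    \<comment> \<open>the moments and the lifetime utility in the statement exist\<close>
    and "integrable M (\<lambda>\<omega>. crra \<theta> (ec 0 \<omega>))"
    and "integrable M (\<lambda>\<omega>. ec 0 \<omega> powr (- \<theta>))"
    and "\<And>t. cond_integrable M (F t) (\<lambda>\<omega>. ec (Suc t) \<omega> powr (- \<theta>) * ed (Suc t) \<omega>)"
    and "\<And>t. AE \<omega> in M. lifetime_defined M (F t) \<beta>
           (\<lambda>s. period_utility M (F s) \<theta> b lam (R s) (level c0 ec s)) t \<omega>"
    \<comment> \<open>growth condition\<close>
    and "\<And>t. AE \<omega> in M. \<beta> * k t \<omega> < 1"
    \<comment> \<open>the valuation ratio does not vary over time (forced by the conclusion)\<close>
    and "\<And>t. AE \<omega> in M. \<beta> * h (Suc t) \<omega> / (1 - \<beta> * k (Suc t) \<omega>) = \<beta> * h t \<omega> / (1 - \<beta> * k t \<omega>)"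
  shows "\<exists>Rf S. equilibrium M c0 d0 ec ed \<theta> \<beta> b lam R Rf S \<and>
    (\<forall>t. AE \<omega> in M. Rf t \<omega> =
       A (ec t \<omega>) / (\<beta> * (\<integral>\<omega>. ec (Suc t) \<omega> powr (- \<theta>) * A (ec (Suc t) \<omega>) \<partial>M))) \<and>
    (\<forall>t. AE \<omega> in M. S t \<omega> / level d0 ed t \<omega> =
       \<beta> * h t \<omega> / (A (ec t \<omega>) * (1 - \<beta> * k t \<omega>))) \<and>
    (\<forall>t. AE \<omega> in M. stock_return S (level d0 ed) t \<omega> =
       A (ec t \<omega>) * ed (Suc t) \<omega> * ((1 - \<beta> * k t \<omega>) / (\<beta> * h t \<omega>) + 1 / A (ec (Suc t) \<omega>))) \<and>
    (\<forall>t. cond_integrable M (F t) (ed (Suc t)) \<longrightarrow>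
       cond_integrable M (F t) (stock_return S (level d0 ed) t) \<and>
       (AE \<omega> in M. E t (stock_return S (level d0 ed) t) \<omega> - Rf t \<omega> =
         A (ec t \<omega>) *
          (E t (\<lambda>\<omega>. ed (Suc t) \<omega> / A (ec (Suc t) \<omega>)) \<omega>
           + E t (ed (Suc t)) \<omega> * (1 - \<beta> * k t \<omega>) / (\<beta> * h t \<omega>)
           - 1 / (\<beta> * E t (\<lambda>\<omega>. ec (Suc t) \<omega> powr (- \<theta>) * A (ec (Suc t) \<omega>)) \<omega>))))"
proof -
  interpret L: gain_loss_economy M c0 d0 ec ed etil \<theta> \<beta> b lam
    using assms(2-5,13-15)
    by (intro gain_loss_economy.intro[OF economy] gain_loss_economy_axioms.intro) (simp_all add: F)
  have Feq: "F = L.\<F>" by (simp add: F fun_eq_iff)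
  have Aeq: "A = L.A" by (simp add: A L.A_def Feps L.Feps_def fun_eq_iff)
  have keq: "k = L.k" by (rule ext) (simp only: k E Feq L.k_def)
  have heq: "h = L.h" by (rule ext) (simp only: h E Feq L.h_def Aeq)
  have Req: "R = L.reference" by (simp add: R L.reference_def fun_eq_iff)
  \<comment> \<open>Growth condition and constancy are phrased with \<open>L.k\<close> and
    \<open>L.q\<close>, so this locale is entered only after the notation of the statement has been
    identified with that of the first one.\<close>
  interpret L: gain_loss_equilibrium M c0 d0 ec ed etil \<theta> \<beta> b lam
    by unfold_locales (use assms(17,18) in \<open>simp_all add: keq heq L.q_def\<close>)
  show ?thesis
    unfolding E Feq Aeq keq heq Req L.integral_ec_A
  proof (rule exI[of _ L.Rf], rule exI[of _ L.S], intro conjI allI impI)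
    show "equilibrium M c0 d0 ec ed \<theta> \<beta> b lam L.reference L.Rf L.S"
      using assms(16) by (intro L.equilibrium_exists) (simp add: Feq Req)
    fix t
    show "AE \<omega> in M. L.Rf t \<omega> = L.A (ec t \<omega>) / (\<beta> * L.K)"
      by (simp add: L.Rf_def)
    show "AE \<omega> in M. L.S t \<omega> / level d0 ed t \<omega> = \<beta> * L.h t \<omega> / (L.A (ec t \<omega>) * (1 - \<beta> * L.k t \<omega>))"
      using L.AE_pos(4)[of t] by eventually_elim (simp add: L.S_def L.q_def mult.commute)
  qed (fact L.stock_return_eq L.risk_premium)+
qed

end
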